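(* With the notation and standing assumptions of the context, $$\left|\frac{\xi N I'}{F(a)}-\mathcal I\right|\le C\left(\frac1N+\exp\left\{-\frac{\epsilon^nN^n}{4}\right\}\right),$$ where $$C=128\,(n+1)!\,\bigl(K_0+\tilde K_0M^kN^{-k}+1\bigr)\exp\Bigl\{(2M^kN^{-k}+1)^{n/(n-k)}\,(16k/n)^{k/(n-k)}\Bigr\}.$$
   Context: Notation: $D(a,r)$ is the open disk; $[z,w]$ is the oriented segment from $z$ to $w$ (a ray if $w$ is infinite); the direction of $z\ne0$ is $z/|z|$; $\bar z$ is complex conjugation; $0^0=1$, $1/0=\infty$, $1/\infty=0$. $\mathbb R^2$ is identified with $\mathbb C$, so $\nabla u=\partial_xu+\mathrm i\,\partial_yu$. Let $F$ be a nonconstant meromorphic function on $\mathbb C$ with set of poles $P$ and set of zeros $Z$. Let $u,\tilde u$ be harmonic on $\mathbb C\setminus(P\cup Z)$ with $\log|F|=u+\tilde u$ there, $u$ nonconstant. Let $a\in\mathbb C$, $r>0$ with $D(a,r)\subset\mathbb C\setminus(P\cup Z)$, and let $f,\tilde f$ be holomorphic on $D(a,r)$ with $\mathrm{Re}f=u$, $\mathrm{Re}\tilde f=\tilde u$ and $F=e^{f+\tilde f}$ on $D(a,r)$. Let $n\ge1$ be minimal with $f^{(n)}(a)\ne0$, $c=f^{(n)}(a)/n!$, fix an $n$th root of $c$, and let $\xi$ and $N$ be its direction and absolute value. If $\tilde u$ is nonconstant, let $k\ge1$ be minimal with $\tilde f^{(k)}(a)\ne0$, $d=\tilde f^{(k)}(a)/k!$,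 $M=|d|^{1/k}$; it is assumed that $k<n$. Put $$K_0=\frac{2^{n+1}}{r^{n+1}}\frac{n!}{|f^{(n)}(a)|}\sup_{\overline{D(a,r/2)}}\{|f|+r|f'|\},\quad\epsilon_0=\frac1{16}\min\Bigl\{r,\frac1{K_0},1\Bigr\},\quad\tilde K_0=\frac{2^{k+1}}{r^{k+1}}\frac{\sup_{\overline{D(a,r/2)}}|\tilde f|}{M^k},\quad\tilde\epsilon_0=\frac1{4\tilde K_0}.$$ If $\tilde u$ is constant, set $k=M=d=\tilde K_0=0$ and $\tilde\epsilon_0=\infty$. Let $\epsilon>0$ satisfy $\epsilon\le\min\{\epsilon_0/128,\ \tilde\epsilon_0/4,\ 1/(4n)\}$. Fix an odd $j\in\{1,\dots,n\}$. Let $\Phi:[0,T^+)\to\mathbb C$ be the maximal steepest-descent curve of $u$ emanating from $a$ with initial direction $\bar\xi e^{\mathrm i\pi j/n}$: the unique $C^1$ curve (with $T^+\in(0,\infty]$ maximal) such that $\Phi(0)=a$, $\Phi'(0)=\bar\xi e^{\mathrm i\pi j/n}$, and for $t\in(0,T^+)$, $\Phi(t)\in\mathbb C\setminus(P\cup Z)$, $\nabla u(\Phi(t))\ne0$ and $\Phi'(t)=-\nabla u(\Phi(t))/|\nabla u(\Phi(t))|$. Let $\tau(\epsilon)=\inf\{0<t<T^+:|\Phi(t)-a|=\epsilon\}$ and let $\eta$ be the direction of $\Phi(\tau(\epsilon))-a$. Define $$I'=\int_a^{\Phi(\tau(\epsilon))}F(z)\,dz\ \text{ (along }\Phi),\qquad\mathcal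 I=\int_{[0,\infty\eta\xi]}\exp\bigl\{w^n+dN^{-k}\bar\xi^{\,k}w^k\bigr\}\,dw,$$ the latter integral being over the ray from $0$ in direction $\eta\xi$ (it converges absolutely). *)

theory Defs
  imports "HOL-Complex_Analysis.Complex_Analysis"
begin

definition partial_x :: "(complex \<Rightarrow> real) \<Rightarrow> complex \<Rightarrow> real" where
  "partial_x u z = deriv (\<lambda>x. u (Complex x (Im z))) (Re z)"

definition partial_y :: "(complex \<Rightarrow> real) \<Rightarrow> complex \<Rightarrow> real" where
  "partial_y u z = deriv (\<lambda>y. u (Complex (Re z) y)) (Im z)"

definition gradient :: "(complex \<Rightarrow> real) \<Rightarrow> complex \<Rightarrow> complex" where
  "gradient u z = complex_of_real (partial_x u z) + \<i> * complex_of_real (partial_y u z)"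

definition C1_on :: "(complex \<Rightarrow> real) \<Rightarrow> complex set \<Rightarrow> bool" where
  "C1_on u S \<longleftrightarrow>
     (\<forall>z\<in>S. (\<lambda>x. u (Complex x (Im z))) differentiable (at (Re z)) \<and>
            (\<lambda>y. u (Complex (Re z) y)) differentiable (at (Im z))) \<and>
     continuous_on S (partial_x u) \<and> continuous_on S (partial_y u)"

definition harmonic_on :: "(complex \<Rightarrow> real) \<Rightarrow> complex set \<Rightarrow> bool"
    (infixl \<open>(harmonic'_on)\<close> 50) where
  "u harmonic_on S \<longleftrightarrow>
     open S \<and> C1_on u S \<and> C1_on (partial_x u) S \<and> C1_on (partial_y u) S \<and>
     (\<forall>z\<in>S. partial_x (partial_x u) z + partial_y (partial_y u) z = 0)"

text \<open>
  A curve is given by its extended-real end time \<open>T\<close> and a total function \<open>\<Phi>\<close>, of which only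
  the values on \<open>curve_domain T\<close>, that is \<open>[0, T)\<close>, matter. The derivative at \<open>0\<close> is one-sided.
\<close>
definition curve_domain :: "ereal \<Rightarrow> real set" where
  "curve_domain T = {t. 0 \<le> t \<and> ereal t < T}"

definition steepest_descent_curve ::
    "(complex \<Rightarrow> real) \<Rightarrow> complex set \<Rightarrow> complex \<Rightarrow> complex \<Rightarrow> ereal \<Rightarrow> (real \<Rightarrow> complex) \<Rightarrow> bool" where
  "steepest_descent_curve u S a v T \<Phi> \<longleftrightarrow>
     0 < T \<and> \<Phi> 0 = a \<and>
     (\<exists>\<Phi>'. (\<forall>t\<in>curve_domain T.
               (\<Phi> has_vector_derivative \<Phi>' t) (at t within curve_domain T)) \<and>
           continuous_on (curve_domain T) \<Phi>' \<and>
           \<Phi>' 0 = v \<and>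
           (\<forall>t\<in>curve_domain T - {0}.
               \<Phi> t \<in> S \<and> gradient u (\<Phi> t) \<noteq> 0 \<and>
               \<Phi>' t = - gradient u (\<Phi> t) / complex_of_real (norm (gradient u (\<Phi> t)))))"

definition maximal_steepest_descent_curve ::
    "(complex \<Rightarrow> real) \<Rightarrow> complex set \<Rightarrow> complex \<Rightarrow> complex \<Rightarrow> ereal \<Rightarrow> (real \<Rightarrow> complex) \<Rightarrow> bool" where
  "maximal_steepest_descent_curve u S a v T \<Phi> \<longleftrightarrow>
     steepest_descent_curve u S a v T \<Phi> \<and>
     (\<forall>T' \<Psi>. steepest_descent_curve u S a v T' \<Psi> \<and> T \<le> T' \<and>
              (\<forall>t\<in>curve_domain T. \<Psi> t = \<Phi> t) \<longrightarrow> T' = T)"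

text \<open>The integral of \<open>g\<close> along the ray from \<open>0\<close> in the direction \<open>\<omega>\<close>, where \<open>norm \<omega> = 1\<close>.\<close>
definition ray_integral :: "complex \<Rightarrow> (complex \<Rightarrow> complex) \<Rightarrow> complex" where
  "ray_integral \<omega> g =
     set_lebesgue_integral lborel {0..} (\<lambda>s. g (complex_of_real s * \<omega>) * \<omega>)"

text \<open>Real powers with the convention \<open>0\<^sup>0 = 1\<close>; note that \<open>0 powr 0 = 0\<close> in the library.\<close>
definition rpow :: "real \<Rightarrow> real \<Rightarrow> real" where
  "rpow x y = (if x = 0 \<and> y = 0 then 1 else x powr y)"

end

theory Submission
  imports Defs
begin

text \<open>
  Along a steepest descent curve of \<open>u = Re f\<close> the value \<open>f\<close> decreases through
  \<open>f a - h\<close> with \<open>h \<ge> 0\<close> real. The curve therefore matters only through its point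
  \<open>p = \<Phi> \<tau>\<close> on the circle of radius \<open>\<epsilon>\<close>: since \<open>F\<close> has a primitive on the disk,
  \<open>I'\<close> is also the integral of \<open>F\<close> over the segment from \<open>a\<close> to \<open>p\<close>, whose direction
  is \<open>\<eta>\<close>. As \<open>f p - f a\<close> is a nonpositive real and differs from \<open>c (p - a)\<^sup>n\<close> by at most
  \<open>N\<^sup>n \<epsilon>\<^sup>n / 1024\<close>, the unit number \<open>\<omega> = (\<xi> \<eta>)\<^sup>n\<close> has real part at most
  \<open>- 511 / 512\<close> (\<open>descent_direction_estimate\<close>). So \<open>exp (c (z - a)\<^sup>n)\<close> decays along the
  segment itself, at almost the optimal rate.

  Rescaling the segment by \<open>x = N |z - a|\<close> turns \<open>\<xi> N I' / F a\<close> into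
  \<open>\<integral>\<^sub>0\<^sup>L \<xi> \<eta> exp (\<omega> x\<^sup>n + \<delta> x\<^sup>k + g x) dx\<close> with \<open>L = \<epsilon> N\<close>, and the ray integral into
  the same expression with \<open>L = \<infinity>\<close> and \<open>g = 0\<close>. Here \<open>g\<close> collects the two Taylor remainders;
  Cauchy's inequalities bound it by \<open>(2 / N) (K0 x\<^bsup>n+1\<^esup> + K2 x\<^bsup>k+1\<^esup>)\<close>
  with \<open>K2 = Kt0 M\<^sup>k / N\<^sup>k\<close>. The removal of \<open>g\<close> costs \<open>O(1 / N)\<close> and the tail beyond \<open>L\<close>
  costs \<open>O(exp (- L\<^sup>n / 4))\<close> (\<open>Laplace_comparison\<close>). The possibly growing factor
  \<open>exp (|\<delta>| x\<^sup>k)\<close> is, by Young's inequality (\<open>Young_power\<close>), at most a constant times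
  \<open>exp (x\<^sup>n / 16)\<close>; that constant is the exponential in \<open>C\<close>.

  It remains to see that the curve reaches the circle of radius \<open>\<epsilon>\<close> at all
  (\<open>steepest_descent_reaches_sphere\<close>). On the closed disk of radius
  \<open>\<epsilon>\<close> the derivative \<open>f'\<close> vanishes at most at \<open>a\<close>. A curve confined to the disk is, after
  a positive time, in a compact set away from \<open>a\<close>, so \<open>u\<close> decreases at a definite rate and the
  curve has finite length. It then converges to a regular point, past which it can be continued
  by a local inverse of \<open>f\<close>; this contradicts maximality.
\<close>

section \<open>Taylor remainders and critical points\<close>

text \<open>
  Cauchy's inequalities on the disk of radius \<open>r / 2\<close> dominate the power series by a geometric
  series of ratio at most \<open>1 / 2\<close>; this ratio is the source of the factor \<open>2\<close>.
\<close>
lemma taylor_remainder_bound: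
  fixes f :: "complex \<Rightarrow> complex"
  assumes hol: "f holomorphic_on ball a r" and r: "r > 0"
    and B: "\<And>z. z \<in> cball a (r / 2) \<Longrightarrow> norm (f z) \<le> B"
    and z: "norm (z - a) \<le> r / 4"
  shows "norm (f z - (\<Sum>m\<le>n. (deriv ^^ m) f a / fact m * (z - a) ^ m))
           \<le> 2 * B * (2 * norm (z - a) / r) ^ (n + 1)"
proof -
  define q where "q = 2 * norm (z - a) / r"
  define t where "t = (\<lambda>m. (deriv ^^ m) f a / fact m * (z - a) ^ m)"
  have q: "0 \<le> q" "q \<le> 1/2"
    using z r by (auto simp: q_def field_simps)
  have B0: "0 \<le> B"
    by (rule order_trans[OF norm_ge_zero B[of a]]) (use r in auto)
  have cauchy: "norm ((deriv ^^ m) f a) \<le> fact m * B / (r/2) ^ m" for m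
  proof (rule Cauchy_inequality)
    show "f holomorphic_on ball a (r/2)" "continuous_on (cball a (r/2)) f"
      using hol r by (auto intro!: holomorphic_on_subset[OF hol] holomorphic_on_imp_continuous_on)
  qed (use r B in \<open>auto simp: dist_norm\<close>)
  have t: "norm (t m) \<le> B * q ^ m" for m
  proof -
    have "norm (t m) = norm ((deriv ^^ m) f a) / fact m * norm (z - a) ^ m"
      by (simp add: t_def norm_mult norm_divide norm_power)
    also have "\<dots> \<le> (fact m * B / (r/2) ^ m) / fact m * norm (z - a) ^ m"
      by (intro mult_right_mono divide_right_mono cauchy) auto
    also have "\<dots> = B * q ^ m"
      using r by (simp add: q_def power_divide power_mult_distrib field_simps)
    finally show ?thesis .
  qed
  have "t sums f z"
    unfolding t_def using z r by (intro holomorphic_power_series[OF hol]) (auto simp: dist_norm norm_minus_commute)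
  then have "(\<lambda>m. t (m + Suc n)) sums (f z - (\<Sum>m<Suc n. t m))"
    by (rule sums_split_initial_segment)
  then have eq: "f z - (\<Sum>m\<le>n. t m) = (\<Sum>m. t (m + Suc n))"
    by (simp add: sums_iff lessThan_Suc_atMost)
  have geo: "(\<lambda>m. (B * q ^ Suc n) * q ^ m) sums ((B * q ^ Suc n) * (1 / (1 - q)))"
    using q by (intro sums_mult geometric_sums) auto
  have "norm (\<Sum>m. t (m + Suc n)) \<le> (\<Sum>m. (B * q ^ Suc n) * q ^ m)"
  proof (rule norm_suminf_le)
    show "norm (t (m + Suc n)) \<le> (B * q ^ Suc n) * q ^ m" for m
      using t[of "m + Suc n"] by (simp add: power_add mult_ac)
  qed (use geo sums_summable in blast)
  also have "\<dots> = (B * q ^ Suc n) * (1 / (1 - q))"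
    using geo by (simp add: sums_iff)
  also have "\<dots> \<le> (B * q ^ Suc n) * 2"
    using q B0 by (intro mult_left_mono) (auto simp: field_simps)
  finally show ?thesis
    using eq by (simp add: t_def q_def mult_ac)
qed

lemma taylor_first_nonzero_bound:
  fixes f :: "complex \<Rightarrow> complex"
  assumes hol: "f holomorphic_on ball a r" and r: "r > 0"
    and B: "\<And>z. z \<in> cball a (r / 2) \<Longrightarrow> norm (f z) \<le> B"
    and n: "n \<ge> 1" "\<And>m. 1 \<le> m \<Longrightarrow> m < n \<Longrightarrow> (deriv ^^ m) f a = 0"
    and z: "norm (z - a) \<le> r / 4"
  shows "norm (f z - f a - (deriv ^^ n) f a / fact n * (z - a) ^ n)
           \<le> 2 * B * (2 * norm (z - a) / r) ^ (n + 1)"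
proof -
  have "(\<Sum>m\<le>n. (deriv ^^ m) f a / fact m * (z - a) ^ m)
      = (\<Sum>m\<in>{0, n}. (deriv ^^ m) f a / fact m * (z - a) ^ m)"
    using n by (intro sum.mono_neutral_right) auto
  then show ?thesis
    using taylor_remainder_bound[OF hol r B z, of n] n(1) by (simp add: diff_diff_eq)
qed

text \<open>
  The leading term of \<open>f'\<close> at \<open>a\<close> is \<open>n c (z - a)\<^bsup>n-1\<^esup>\<close>, and \<open>small\<close> makes it exceed the
  remainder of \<open>f'\<close> after that term.
\<close>
lemma deriv_nonzero_near_critical_point:
  fixes f :: "complex \<Rightarrow> complex"
  assumes hol: "f holomorphic_on ball a r" and r: "r > 0"
    and B: "\<And>z. z \<in> cball a (r / 2) \<Longrightarrow> r * norm (deriv f z) \<le> B"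
    and n: "n \<ge> 1" "\<And>m. 1 \<le> m \<Longrightarrow> m < n \<Longrightarrow> (deriv ^^ m) f a = 0"
    and z: "z \<noteq> a" "norm (z - a) \<le> r / 4"
    and small: "2 ^ (n + 1) / r ^ (n + 1) * B * norm (z - a) < norm ((deriv ^^ n) f a / fact n)"
  shows "deriv f z \<noteq> 0"
proof
  assume zero: "deriv f z = 0"
  obtain l where l: "n = Suc l" using n(1) by (cases n) auto
  define s where "s = norm (z - a)"
  have s: "s > 0" using z(1) by (simp add: s_def)
  have hol': "deriv f holomorphic_on ball a r"
    by (intro holomorphic_deriv hol) auto
  have B': "norm (deriv f z) \<le> B / r" if "z \<in> cball a (r / 2)" for z
    using B[OF that] r by (simp add: field_simps)
  have der: "(deriv ^^ m) (deriv f) = (deriv ^^ Suc m) f" for m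
    by (simp add: funpow_swap1)
  have "(\<Sum>m\<le>l. (deriv ^^ m) (deriv f) a / fact m * (z - a) ^ m)
      = (\<Sum>m\<in>{l}. (deriv ^^ m) (deriv f) a / fact m * (z - a) ^ m)"
    using n(2) l by (intro sum.mono_neutral_right) (auto simp del: funpow.simps simp: der)
  also have "\<dots> = of_nat n * ((deriv ^^ n) f a / fact n) * (z - a) ^ l"
  proof -
    have "of_nat n * ((deriv ^^ n) f a / fact n) = (deriv ^^ n) f a / fact l"
      by (simp add: l fact_Suc del: funpow.simps of_nat_Suc)
    then show ?thesis by (simp add: der l del: funpow.simps of_nat_Suc fact_Suc)
  qed
  finally have "norm (of_nat n * ((deriv ^^ n) f a / fact n) * (z - a) ^ l) \<le> 2 * (B / r) * (2 * s / r) ^ (l + 1)"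
    using taylor_remainder_bound[OF hol' r B' z(2), of l] zero by (simp add: s_def)
  also have "2 * (B / r) * (2 * s / r) ^ (l + 1) = (2 ^ (n + 1) / r ^ (n + 1) * B * s) * s ^ l"
    using r by (simp add: l power_mult_distrib power_divide field_simps)
  also have "\<dots> < norm ((deriv ^^ n) f a / fact n) * s ^ l"
    using small s by (intro mult_strict_right_mono) (auto simp: s_def)
  also have "\<dots> \<le> real n * (norm ((deriv ^^ n) f a / fact n) * s ^ l)"
    using n(1) s mult_right_mono[of 1 "real n" "norm ((deriv ^^ n) f a / fact n) * s ^ l"] by simp
  also have "\<dots> = norm (of_nat n * ((deriv ^^ n) f a / fact n) * (z - a) ^ l)"
    by (simp add: norm_mult norm_divide norm_power s_def mult_ac)
  finally show False by simp
qed

text \<open>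
  These are the Cauchy-Riemann equations, read off by differentiating \<open>f\<close> along a horizontal and
  a vertical line through \<open>z\<close>.
\<close>
lemma gradient_Re_holomorphic:
  assumes hol: "f holomorphic_on A" and A: "open A"
    and u: "\<And>z. z \<in> A \<Longrightarrow> u z = Re (f z)" and z: "z \<in> A"
  shows "gradient u z = cnj (deriv f z)"
proof -
  have df: "(f has_field_derivative deriv f z) (at z)"
    using hol A z by (rule holomorphic_derivI)
  have line: "((\<lambda>x. u (p + of_real x * v)) has_real_derivative Re (deriv f z * v)) (at x0)"
    if p: "p + of_real x0 * v = z" for p v x0
  proof -
    have "((\<lambda>x::real. p + of_real x * v) has_vector_derivative v) (at x0)"
      by (auto intro!: derivative_eq_intros)
    moreover have "(f has_field_derivative deriv f z) (at (p + of_real x0 * v))"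
      using df p by simp
    ultimately have "((\<lambda>x. f (p + of_real x * v)) has_vector_derivative v * deriv f z) (at x0)"
      using field_vector_diff_chain_at[of "\<lambda>x::real. p + of_real x * v" v x0 f] by (simp add: o_def)
    then have "((\<lambda>x. f (p + of_real x * v)) has_vector_derivative deriv f z * v) (at x0)"
      by (simp add: mult.commute)
    then have "((\<lambda>x. Re (f (p + of_real x * v))) has_real_derivative Re (deriv f z * v)) (at x0)"
      unfolding has_real_derivative_iff_has_vector_derivative
      by (rule bounded_linear.has_vector_derivative[OF bounded_linear_Re])
    moreover have "open ((\<lambda>x::real. p + of_real x * v) -` A)"
      by (intro open_vimage A continuous_intros)
    then have "\<forall>\<^sub>F x in nhds x0. p + of_real x * v \<in> A"
      using p z by (auto simp: eventually_nhds)
    then have "\<forall>\<^sub>F x in nhds x0. Re (f (p + of_real x * v)) = u (p + of_real x * v)"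
      by eventually_elim (use u in auto)
    ultimately show ?thesis
      by (subst (asm) DERIV_cong_ev[OF refl _ refl]) auto
  qed
  have horizontal: "Complex 0 (Im z) + of_real x * 1 = Complex x (Im z)" for x
    by (simp add: complex_eq_iff)
  have "partial_x u z = Re (deriv f z)"
    using line[of "Complex 0 (Im z)" "Re z" 1, unfolded horizontal] unfolding partial_x_def
    by (intro DERIV_imp_deriv) simp
  moreover have vertical: "Complex (Re z) 0 + of_real y * \<i> = Complex (Re z) y" for y
    by (simp add: complex_eq_iff)
  have "partial_y u z = - Im (deriv f z)"
    using line[of "Complex (Re z) 0" "Im z" \<i>, unfolded vertical] unfolding partial_y_def
    by (intro DERIV_imp_deriv) simp
  ultimately show ?thesis
    by (simp add: gradient_def complex_eq_iff)
qed

lemma holomorphic_constant_if_Re_constant: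
  fixes f :: "complex \<Rightarrow> complex"
  assumes hol: "f holomorphic_on A" and A: "open A" "connected A"
    and Re: "\<And>z. z \<in> A \<Longrightarrow> Re (f z) = b" and zw: "z \<in> A" "w \<in> A"
  shows "f z = f w"
proof -
  have "deriv f z = 0" if "z \<in> A" for z
    using gradient_Re_holomorphic[OF hol A(1) _ that, of "\<lambda>_. b"] Re
    by (simp add: gradient_def partial_x_def partial_y_def)
  then have "f constant_on A"
    using holomorphic_derivI[OF hol A(1)] A
    by (intro DERIV_zero_connected_constant_on[where K = "{}"])
      (auto intro: holomorphic_on_imp_continuous_on[OF hol])
  then show ?thesis using zw by (auto simp: constant_on_def)
qed


section \<open>Steepest descent of the real part of a holomorphic function\<close>

text \<open>
  In the coordinate \<open>f\<close> steepest descent follows the straight line \<open>f p - x\<close>. Pulling this line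
  back by a local inverse \<open>g\<close> of \<open>f\<close> and passing to arc length solves the differential equation of
  steepest descent explicitly, on both sides of time \<open>0\<close>.
\<close>
lemma steepest_descent_through_regular_point:
  fixes f :: "complex \<Rightarrow> complex"
  assumes hol: "f holomorphic_on A" and A: "open A" "p \<in> A" and reg: "deriv f p \<noteq> 0"
  obtains \<delta> \<gamma> where "\<delta> > 0" "\<gamma> 0 = p"
    "\<And>t. \<bar>t\<bar> < \<delta> \<Longrightarrow> \<gamma> t \<in> A" "\<And>t. \<bar>t\<bar> < \<delta> \<Longrightarrow> deriv f (\<gamma> t) \<noteq> 0"
    "\<And>t. \<bar>t\<bar> < \<delta> \<Longrightarrow> (\<gamma> has_vector_derivative
        - cnj (deriv f (\<gamma> t)) / of_real (norm (deriv f (\<gamma> t)))) (at t)"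
proof -
  obtain e where e: "e > 0" "ball p e \<subseteq> A" "inj_on f (ball p e)"
    using has_complex_derivative_locally_injective[OF hol A(2,1) reg] .
  define U where "U = ball p e"
  have U: "open U" "p \<in> U" "U \<subseteq> A" "f holomorphic_on U" "inj_on f U"
    using e hol by (auto simp: U_def intro: holomorphic_on_subset)
  obtain g where g: "g holomorphic_on (f ` U)"
      "\<And>z. z \<in> U \<Longrightarrow> deriv f z * deriv g (f z) = 1" "\<And>z. z \<in> U \<Longrightarrow> g (f z) = z"
    using holomorphic_has_inverse[OF U(4,1,5)] by blast
  have fU: "open (f ` U)"
    by (rule open_mapping_thm3[OF U(4,1,5)])
  then obtain d where d: "d > 0" "cball (f p) d \<subseteq> f ` U"
    using U(2) open_contains_cball by blast
  have fpU: "f p - of_real x \<in> f ` U" if "\<bar>x\<bar> \<le> d" for x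
    using d(2) that by (auto simp: dist_norm)
  define \<beta> where "\<beta> = (\<lambda>x::real. g (f p - of_real x))"
  have \<beta>: "\<beta> x \<in> U" "f (\<beta> x) = f p - of_real x" if "\<bar>x\<bar> \<le> d" for x
    using fpU[OF that] g(3) by (auto simp: \<beta>_def)
  have d\<beta>: "(\<beta> has_vector_derivative - deriv g (f p - of_real x)) (at x)" if "\<bar>x\<bar> \<le> d" for x
  proof -
    have "((\<lambda>x::real. f p - of_real x) has_vector_derivative -1) (at x)"
      by (auto intro!: derivative_eq_intros)
    from field_vector_diff_chain_at[OF this holomorphic_derivI[OF g(1) fU fpU[OF that]]]
    show ?thesis by (simp add: \<beta>_def o_def)
  qed
  \<comment> \<open>\<open>s\<close> is the speed of \<open>\<beta>\<close>, \<open>l\<close> its arc length from \<open>0\<close>, and \<open>\<sigma>\<close> the inverse of \<open>l\<close>\<close>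
  define s where "s = (\<lambda>x::real. norm (deriv g (f p - of_real x)))"
  have s_pos: "s x > 0" if "\<bar>x\<bar> \<le> d" for x
    using g(2)[OF \<beta>(1)[OF that]] \<beta>(2)[OF that] by (auto simp: s_def)
  have "continuous_on (f ` U) (deriv g)"
    by (intro holomorphic_on_imp_continuous_on holomorphic_deriv g fU)
  then have "continuous_on {-d..d} (\<lambda>x::real. deriv g (f p - of_real x))"
    by (rule continuous_on_compose2) (auto intro!: fpU continuous_intros)
  then have s_cont: "continuous_on {-d..d} s"
    unfolding s_def by (rule continuous_on_norm)
  define l where "l = (\<lambda>x. integral {-d..x} s - integral {-d..0} s)"
  have dl_within: "(l has_real_derivative s x) (at x within {-d..d})" if "x \<in> {-d..d}" for x
    unfolding l_def using integral_has_real_derivative[OF s_cont that]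
    by (auto intro!: derivative_eq_intros)
  have dl: "(l has_real_derivative s x) (at x)" if "\<bar>x\<bar> < d" for x
  proof -
    have "- d < x" "x < d" using that by auto
    then show ?thesis
      using dl_within[of x] at_within_Icc_at[of "-d" x d] by simp
  qed
  define b where "b = d / 2"
  have b: "0 < b" "b < d" using d(1) by (auto simp: b_def)
  have l_less: "l x < l y" if "-b \<le> x" "x < y" "y \<le> b" for x y
    using that b
    by (intro DERIV_pos_imp_increasing[OF that(2)]) (force intro!: dl s_pos exI[of _ "s _"])
  have l_cont: "isCont l x" if "\<bar>x\<bar> \<le> b" for x
    using dl[of x] that b DERIV_isCont by auto
  have l_inj: "inj_on l {-b..b}"
    by (rule linorder_inj_onI') (use l_less in force)
  define \<sigma> where "\<sigma> = inv_into {-b..b} l"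
  have \<sigma>l: "\<sigma> (l x) = x" if "\<bar>x\<bar> \<le> b" for x
    unfolding \<sigma>_def using that by (intro inv_into_f_f[OF l_inj]) auto
  have \<sigma>_ex: "\<exists>x. \<bar>x\<bar> < b \<and> l x = y" if "l (-b) < y" "y < l b" for y
  proof -
    have "\<exists>x. -b \<le> x \<and> x \<le> b \<and> l x = y"
      using that b l_cont by (intro IVT) auto
    then show ?thesis
      using that by (metis abs_less_iff less_eq_real_def less_irrefl minus_less_iff)
  qed
  have \<sigma>: "\<bar>\<sigma> y\<bar> < b" "l (\<sigma> y) = y" if "l (-b) < y" "y < l b" for y
    using \<sigma>_ex[OF that] \<sigma>l by force+
  have d\<sigma>: "(\<sigma> has_real_derivative inverse (s (\<sigma> y))) (at y)" if y: "l (-b) < y" "y < l b" for y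
  proof (rule DERIV_inverse_function[OF _ _ y])
    show "(l has_real_derivative s (\<sigma> y)) (at (\<sigma> y))"
      using \<sigma>(1)[OF y] b by (intro dl) auto
    show "s (\<sigma> y) \<noteq> 0"
      using s_pos[of "\<sigma> y"] \<sigma>(1)[OF y] b by auto
    show "\<And>y. l (- b) < y \<Longrightarrow> y < l b \<Longrightarrow> l (\<sigma> y) = y"
      by (rule \<sigma>)
    have "isCont \<sigma> (l (\<sigma> y))"
      by (rule isCont_inverse_function[of "b - \<bar>\<sigma> y\<bar>"]) (use \<sigma>(1)[OF y] in \<open>auto intro!: \<sigma>l l_cont\<close>)
    then show "isCont \<sigma> y" by (simp add: \<sigma>(2)[OF y])
  qed
  define \<delta> where "\<delta> = min (l b) (- l (-b))"
  have l0: "l 0 = 0" by (simp add: l_def)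
  have \<delta>: "\<delta> > 0" using l_less[of 0 b] l_less[of "-b" 0] b by (auto simp: \<delta>_def l0)
  define \<gamma> where "\<gamma> = (\<lambda>t. \<beta> (\<sigma> t))"
  show ?thesis
  proof (rule that[of \<delta> \<gamma>])
    show "\<gamma> 0 = p"
      using \<sigma>l[of 0] b U(2) g(3) by (simp add: \<gamma>_def l0 \<beta>_def)
    fix t assume "\<bar>t\<bar> < \<delta>"
    then have t: "l (-b) < t" "t < l b" by (auto simp: \<delta>_def)
    have \<sigma>t: "\<bar>\<sigma> t\<bar> \<le> d" using \<sigma>(1)[OF t] b by auto
    show "\<gamma> t \<in> A" using \<beta>(1)[OF \<sigma>t] U(3) by (auto simp: \<gamma>_def)
    have inv: "deriv f (\<gamma> t) * deriv g (f p - of_real (\<sigma> t)) = 1"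
      using g(2)[OF \<beta>(1)[OF \<sigma>t]] \<beta>(2)[OF \<sigma>t] by (simp add: \<gamma>_def)
    then show nz: "deriv f (\<gamma> t) \<noteq> 0" by auto
    have "(\<gamma> has_vector_derivative inverse (s (\<sigma> t)) *\<^sub>R (- deriv g (f p - of_real (\<sigma> t)))) (at t)"
      using vector_diff_chain_at[OF d\<sigma>[OF t, unfolded has_real_derivative_iff_has_vector_derivative] d\<beta>[OF \<sigma>t]]
      by (simp add: \<gamma>_def o_def)
    moreover have g': "deriv g (f p - of_real (\<sigma> t)) = 1 / deriv f (\<gamma> t)"
      using inv nz by (simp add: field_simps)
    have "inverse (s (\<sigma> t)) *\<^sub>R (- deriv g (f p - of_real (\<sigma> t)))
        = - (of_real (norm (deriv f (\<gamma> t))) / deriv f (\<gamma> t))"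
      unfolding s_def g' by (simp add: scaleR_conv_of_real norm_divide)
    also have "\<dots> = - cnj (deriv f (\<gamma> t)) / of_real (norm (deriv f (\<gamma> t)))"
      using nz complex_norm_square[of "deriv f (\<gamma> t)"] by (simp add: field_simps power2_eq_square)
    ultimately show "(\<gamma> has_vector_derivative
        - cnj (deriv f (\<gamma> t)) / of_real (norm (deriv f (\<gamma> t)))) (at t)"
      by simp
  qed (rule \<delta>)
qed

text \<open>
  The derivative of \<open>f\<close> along the curve is \<open>- |f'|\<close>, a real number; both conclusions are the mean
  value theorem applied to the imaginary and the real part.
\<close>
lemma descent_along_curve:
  fixes f :: "complex \<Rightarrow> complex"
  assumes hol: "f holomorphic_on A" and A: "open A"
    and st: "s < t" and cont: "continuous_on {s..t} \<Phi>"
    and inA: "\<And>x. x \<in> {s..t} \<Longrightarrow> \<Phi> x \<in> A"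
    and deriv: "\<And>x. s < x \<Longrightarrow> x < t \<Longrightarrow> (\<Phi> has_vector_derivative
          - cnj (deriv f (\<Phi> x)) / of_real (norm (deriv f (\<Phi> x)))) (at x)"
  shows "Im (f (\<Phi> t)) = Im (f (\<Phi> s))"
    and "\<exists>x. s < x \<and> x < t \<and> Re (f (\<Phi> t)) = Re (f (\<Phi> s)) - norm (deriv f (\<Phi> x)) * (t - s)"
proof -
  have cf: "continuous_on {s..t} (\<lambda>x. f (\<Phi> x))"
    by (rule continuous_on_compose2[OF holomorphic_on_imp_continuous_on[OF hol] cont]) (use inA in auto)
  have df: "((\<lambda>x. f (\<Phi> x)) has_vector_derivative of_real (- norm (deriv f (\<Phi> x)))) (at x)"
    if "s < x" "x < t" for x
  proof -
    have "\<Phi> x \<in> A" using inA that by auto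
    from field_vector_diff_chain_at[OF deriv[OF that] holomorphic_derivI[OF hol A this]]
    have "((\<lambda>x. f (\<Phi> x)) has_vector_derivative
        - cnj (deriv f (\<Phi> x)) / of_real (norm (deriv f (\<Phi> x))) * deriv f (\<Phi> x)) (at x)"
      by (simp add: o_def)
    moreover have "- cnj (deriv f (\<Phi> x)) / of_real (norm (deriv f (\<Phi> x))) * deriv f (\<Phi> x)
        = of_real (- norm (deriv f (\<Phi> x)))"
      using complex_norm_square[of "deriv f (\<Phi> x)"]
      by (cases "deriv f (\<Phi> x) = 0") (simp_all add: field_simps power2_eq_square)
    ultimately show ?thesis by simp
  qed
  have "((\<lambda>x. Im (f (\<Phi> x))) has_derivative (\<lambda>h. h * 0)) (at x)" if "s < x" "x < t" for x
    using bounded_linear.has_vector_derivative[OF bounded_linear_Im df[OF that]]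
    by (simp add: has_vector_derivative_def)
  from mvt[OF st continuous_on_Im[OF cf] this] show "Im (f (\<Phi> t)) = Im (f (\<Phi> s))"
    by force
  have "((\<lambda>x. Re (f (\<Phi> x))) has_derivative (\<lambda>h. h * - norm (deriv f (\<Phi> x)))) (at x)"
    if "s < x" "x < t" for x
    using bounded_linear.has_vector_derivative[OF bounded_linear_Re df[OF that]]
    by (simp add: has_vector_derivative_def)
  from mvt[OF st continuous_on_Re[OF cf] this]
  show "\<exists>x. s < x \<and> x < t \<and> Re (f (\<Phi> t)) = Re (f (\<Phi> s)) - norm (deriv f (\<Phi> x)) * (t - s)"
    by (auto simp: algebra_simps)
qed

text \<open>
  A curve of finite length that converges to a regular point is prolonged by
  \<open>steepest_descent_through_regular_point\<close>. The prolonged curve \<open>\<Psi>\<close> is continuously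
  differentiable at the junction because its velocity \<open>V\<close> is continuous there and
  \<open>\<Psi>\<close> is the integral of \<open>V\<close>: the fundamental theorem of calculus tolerates the single exceptional
  point \<open>T\<close>.
\<close>
lemma steepest_descent_curve_extends:
  fixes f :: "complex \<Rightarrow> complex"
  assumes hol: "f holomorphic_on A" and A: "open A" "A \<subseteq> S"
    and u: "\<And>z. z \<in> A \<Longrightarrow> u z = Re (f z)"
    and curve: "steepest_descent_curve u S a v (ereal T) \<Phi>"
    and inA: "\<And>t. 0 < t \<Longrightarrow> t < T \<Longrightarrow> \<Phi> t \<in> A"
    and lim: "(\<Phi> \<longlongrightarrow> p) (at_left T)" and p: "p \<in> A" "deriv f p \<noteq> 0"
  obtains T' \<Psi> where "T < T'" "steepest_descent_curve u S a v (ereal T') \<Psi>"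
    "\<And>t. t < T \<Longrightarrow> \<Psi> t = \<Phi> t"
proof -
  define W where "W = (\<lambda>z. - cnj (deriv f z) / of_real (norm (deriv f z)))"
  have grad: "gradient u z = cnj (deriv f z)" if "z \<in> A" for z
    using gradient_Re_holomorphic[OF hol A(1) u that] by simp
  have dom: "curve_domain (ereal T) = {0..<T}" for T
    by (auto simp: curve_domain_def)
  obtain \<Phi>' where T: "0 < T" and \<Phi>0: "\<Phi> 0 = a" and \<Phi>'0: "\<Phi>' 0 = v"
    and d\<Phi>_within: "\<And>t. t \<in> {0..<T} \<Longrightarrow> (\<Phi> has_vector_derivative \<Phi>' t) (at t within {0..<T})"
    and c\<Phi>': "continuous_on {0..<T} \<Phi>'"
    and flow: "\<And>t. t \<in> {0..<T} - {0} \<Longrightarrow> \<Phi> t \<in> S \<and> gradient u (\<Phi> t) \<noteq> 0 \<and>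
        \<Phi>' t = - gradient u (\<Phi> t) / of_real (norm (gradient u (\<Phi> t)))"
    using curve unfolding steepest_descent_curve_def dom by auto
  have flow': "deriv f (\<Phi> t) \<noteq> 0" "\<Phi>' t = W (\<Phi> t)" if "0 < t" "t < T" for t
    using flow[of t] that grad[OF inA[OF that]] by (auto simp: W_def)
  have d\<Phi>: "(\<Phi> has_vector_derivative \<Phi>' t) (at t)" if "0 < t" "t < T" for t
    using d\<Phi>_within[of t] that
    by (metis at_within_interior atLeastLessThan_iff greaterThanLessThan_iff interior_atLeastLessThan less_imp_le)
  obtain \<delta> \<gamma> where \<delta>: "\<delta> > 0" and \<gamma>0: "\<gamma> 0 = p"
    and \<gamma>: "\<And>t. \<bar>t\<bar> < \<delta> \<Longrightarrow> \<gamma> t \<in> A" "\<And>t. \<bar>t\<bar> < \<delta> \<Longrightarrow> deriv f (\<gamma> t) \<noteq> 0"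
    "\<And>t. \<bar>t\<bar> < \<delta> \<Longrightarrow> (\<gamma> has_vector_derivative W (\<gamma> t)) (at t)"
    using steepest_descent_through_regular_point[OF hol A(1) p] unfolding W_def by blast
  define T' where "T' = T + \<delta> / 2"
  have T': "T < T'" "T' < T + \<delta>" using \<delta> by (auto simp: T'_def)
  define \<Psi> where "\<Psi> = (\<lambda>t. if t < T then \<Phi> t else \<gamma> (t - T))"
  define V where "V = (\<lambda>t. if t < T then \<Phi>' t else W (\<gamma> (t - T)))"
  have \<Psi>_in: "\<Psi> t \<in> A" "deriv f (\<Psi> t) \<noteq> 0" "V t = W (\<Psi> t)" if "0 < t" "t \<le> T'" for t
    using that inA flow' \<gamma> T' by (auto simp: \<Psi>_def V_def)
  have d\<gamma>: "((\<lambda>t. \<gamma> (t - T)) has_vector_derivative W (\<gamma> (t - T))) (at t)" if "T \<le> t" "t \<le> T'" for t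
  proof -
    have "((\<lambda>t. t - T) has_vector_derivative 1) (at t)"
      by (auto intro!: derivative_eq_intros)
    from vector_diff_chain_at[OF this \<gamma>(3)] that T' show ?thesis by (auto simp: o_def)
  qed
  have d\<Psi>: "(\<Psi> has_vector_derivative V t) (at t)" if "0 < t" "t \<le> T'" "t \<noteq> T" for t
  proof (cases "t < T")
    case True
    show ?thesis
      by (rule has_vector_derivative_transform_within_open[OF _ open_lessThan[of T]])
        (use d\<Phi> that True in \<open>auto simp: \<Psi>_def V_def\<close>)
  next
    case False
    show ?thesis
      by (rule has_vector_derivative_transform_within_open[OF _ open_greaterThan[of T]])
        (use d\<gamma> that False in \<open>auto simp: \<Psi>_def V_def\<close>)
  qed
  have c\<Phi>: "continuous (at 0 within {0..<T}) \<Phi>"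
    using d\<Phi>_within[of 0] T by (intro has_vector_derivative_continuous) auto
  have c\<Psi>: "continuous_on {0..T'} \<Psi>"
    unfolding continuous_on_eq_continuous_within
  proof
    fix t assume t: "t \<in> {0..T'}"
    consider "t = 0" | "t = T" | "0 < t" "t \<noteq> T" using t by force
    then show "continuous (at t within {0..T'}) \<Psi>"
    proof cases
      case 1
      have "at 0 within {0..T'} = at (0::real) within {0..<T}"
        using T T' by (intro at_within_nhd[of _ "{..<T}"]) auto
      moreover have "continuous (at 0 within {0..<T}) \<Psi>"
        using continuous_transform_within[OF c\<Phi>, of T] T by (auto simp: \<Psi>_def)
      ultimately show ?thesis using 1 by simp
    next
      case 2
      have "(\<Psi> \<longlongrightarrow> p) (at_left T)"
        by (rule Lim_transform_eventually[OF lim]) (auto simp: \<Psi>_def eventually_at_filter)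
      moreover have "isCont (\<lambda>t. \<gamma> (t - T)) T"
        using d\<gamma>[of T] T' by (intro has_vector_derivative_continuous) auto
      then have "((\<lambda>t. \<gamma> (t - T)) \<longlongrightarrow> p) (at_right T)"
        by (simp add: isCont_def \<gamma>0 filterlim_at_split)
      then have "(\<Psi> \<longlongrightarrow> p) (at_right T)"
        by (rule Lim_transform_eventually) (auto simp: \<Psi>_def eventually_at_filter)
      ultimately have "isCont \<Psi> T"
        by (simp add: isCont_def filterlim_at_split \<Psi>_def \<gamma>0)
      then show ?thesis using 2 by (simp add: continuous_at_imp_continuous_at_within)
    next
      case 3
      then have "isCont \<Psi> t"
        using d\<Psi>[of t] t by (intro has_vector_derivative_continuous) auto
      then show ?thesis by (rule continuous_at_imp_continuous_at_within)
    qed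
  qed
  \<comment> \<open>continuity at \<open>0\<close> is that of \<open>\<Phi>'\<close>; at positive times it is that of the direction field \<open>W\<close>, which is singular at a critical point \<open>a\<close>\<close>
  have "continuous_on ({0..<T} \<union> {0<..T'}) V"
  proof (rule continuous_on_Un_local_open)
    have "{0..<T} = ({0..<T} \<union> {0<..T'}) \<inter> {..<T}" "{0<..T'} = ({0..<T} \<union> {0<..T'}) \<inter> {0<..}"
      using T T' by auto
    then show "openin (top_of_set ({0..<T} \<union> {0<..T'})) {0..<T}"
      and "openin (top_of_set ({0..<T} \<union> {0<..T'})) {0<..T'}"
      by (metis openin_open_Int open_lessThan, metis openin_open_Int open_greaterThan)
    show "continuous_on {0..<T} V"
      using c\<Phi>' by (rule continuous_on_eq) (auto simp: V_def)
    have "continuous_on {z\<in>A. deriv f z \<noteq> 0} W"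
      unfolding W_def
      by (intro continuous_intros holomorphic_on_imp_continuous_on
            holomorphic_on_subset[OF holomorphic_deriv[OF hol A(1)]]) auto
    then have "continuous_on {0<..T'} (\<lambda>t. W (\<Psi> t))"
      by (rule continuous_on_compose2) (use \<Psi>_in c\<Psi> in \<open>auto intro: continuous_on_subset\<close>)
    then show "continuous_on {0<..T'} V"
      by (rule continuous_on_eq) (use \<Psi>_in in auto)
  qed
  moreover have "{0..<T} \<union> {0<..T'} = {0..T'}" using T T' by auto
  ultimately have cV: "continuous_on {0..T'} V" by simp
  have int: "\<Psi> t = a + integral {0..t} V" if t: "t \<in> {0..T'}" for t
  proof -
    have "(V has_integral (\<Psi> t - \<Psi> 0)) {0..t}"
      by (rule fundamental_theorem_of_calculus_interior_strong[of "{T}"])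
        (use t d\<Psi> in \<open>auto intro: continuous_on_subset[OF c\<Psi>]\<close>)
    then show ?thesis
      using T \<Phi>0 by (simp add: integral_unique \<Psi>_def)
  qed
  have d\<Psi>_within: "(\<Psi> has_vector_derivative V t) (at t within {0..T'})" if t: "t \<in> {0..T'}" for t
  proof (rule has_vector_derivative_transform[OF t])
    show "((\<lambda>t. a + integral {0..t} V) has_vector_derivative V t) (at t within {0..T'})"
      using integral_has_vector_derivative[OF cV t] by (auto intro!: derivative_eq_intros)
  qed (use int in auto)
  show ?thesis
  proof (rule that[of T' \<Psi>])
    show "steepest_descent_curve u S a v (ereal T') \<Psi>"
      unfolding steepest_descent_curve_def dom
    proof (intro conjI exI[of _ V] ballI)
      show "0 < ereal T'" "\<Psi> 0 = a" "V 0 = v"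
        using T T' \<Phi>0 \<Phi>'0 by (auto simp: \<Psi>_def V_def)
      show "continuous_on {0..<T'} V"
        by (rule continuous_on_subset[OF cV]) auto
      show "(\<Psi> has_vector_derivative V t) (at t within {0..<T'})" if "t \<in> {0..<T'}" for t
        using that by (intro has_vector_derivative_within_subset[OF d\<Psi>_within]) auto
    next
      fix t assume "t \<in> {0..<T'} - {0}"
      then have t: "0 < t" "t \<le> T'" by auto
      show "\<Psi> t \<in> S" "gradient u (\<Psi> t) \<noteq> 0"
        "V t = - gradient u (\<Psi> t) / complex_of_real (norm (gradient u (\<Psi> t)))"
        using \<Psi>_in[OF t] A(2) by (auto simp: grad W_def)
    qed
  qed (use T' in \<open>auto simp: \<Psi>_def\<close>)
qed

lemma ereal_less_trans_real: "x < t \<Longrightarrow> ereal t < T \<Longrightarrow> ereal x < T"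
  by (rule less_trans[of _ "ereal t"]) auto

lemma Icc_subset_curve_domain: "ereal t < T \<Longrightarrow> {0..t} \<subseteq> curve_domain T"
  unfolding curve_domain_def by (auto intro: le_less_trans[of _ "ereal t"])

lemma steepest_descent_curve_holomorphic:
  fixes f :: "complex \<Rightarrow> complex"
  assumes hol: "f holomorphic_on A" and A: "open A"
    and u: "\<And>z. z \<in> A \<Longrightarrow> u z = Re (f z)"
    and curve: "steepest_descent_curve u S a v T \<Phi>"
  obtains \<Phi>' where "0 < T" "\<Phi> 0 = a"
    "continuous_on (curve_domain T) \<Phi>" "continuous_on (curve_domain T) \<Phi>'"
    "\<And>t. 0 < t \<Longrightarrow> ereal t < T \<Longrightarrow> (\<Phi> has_vector_derivative \<Phi>' t) (at t)"
    "\<And>t. 0 < t \<Longrightarrow> ereal t < T \<Longrightarrow> \<Phi> t \<in> A \<Longrightarrow> deriv f (\<Phi> t) \<noteq> 0"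
    "\<And>t. 0 < t \<Longrightarrow> ereal t < T \<Longrightarrow> \<Phi> t \<in> A \<Longrightarrow>
        \<Phi>' t = - cnj (deriv f (\<Phi> t)) / of_real (norm (deriv f (\<Phi> t)))"
proof -
  obtain \<Phi>' where T: "0 < T" and \<Phi>0: "\<Phi> 0 = a"
    and d: "\<And>t. t \<in> curve_domain T \<Longrightarrow> (\<Phi> has_vector_derivative \<Phi>' t) (at t within curve_domain T)"
    and c: "continuous_on (curve_domain T) \<Phi>'"
    and flow: "\<And>t. t \<in> curve_domain T - {0} \<Longrightarrow> gradient u (\<Phi> t) \<noteq> 0 \<and>
        \<Phi>' t = - gradient u (\<Phi> t) / of_real (norm (gradient u (\<Phi> t)))"
    using curve unfolding steepest_descent_curve_def by auto
  show ?thesis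
  proof (rule that[of \<Phi>'])
    show "continuous_on (curve_domain T) \<Phi>"
      unfolding continuous_on_eq_continuous_within
      using d has_vector_derivative_continuous by blast
    fix t assume t: "0 < t" "ereal t < T"
    then have dom: "t \<in> curve_domain T - {0}" by (auto simp: curve_domain_def)
    obtain q where q: "ereal t < ereal q" "ereal q < T"
      using ereal_dense2[OF t(2)] by blast
    have "{0<..<q} \<subseteq> curve_domain T"
    proof
      fix x assume "x \<in> {0<..<q}"
      then show "x \<in> curve_domain T"
        using less_trans[of "ereal x" "ereal q" T] q(2) by (simp add: curve_domain_def)
    qed
    then have "t \<in> interior (curve_domain T)"
      using q(1) t(1) by (intro interiorI[OF open_greaterThanLessThan[of 0 q]]) auto
    then show "(\<Phi> has_vector_derivative \<Phi>' t) (at t)"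
      using d[of t] dom by (simp add: at_within_interior[of t "curve_domain T"])
    assume "\<Phi> t \<in> A"
    then have grad: "gradient u (\<Phi> t) = cnj (deriv f (\<Phi> t))"
      by (intro gradient_Re_holomorphic[OF hol A u])
    show "deriv f (\<Phi> t) \<noteq> 0"
      using flow[OF dom] by (simp add: grad)
    show "\<Phi>' t = - cnj (deriv f (\<Phi> t)) / of_real (norm (deriv f (\<Phi> t)))"
      using conjunct2[OF flow[OF dom]] unfolding grad complex_mod_cnj .
  qed (use T \<Phi>0 c in auto)
qed

text \<open>
  Suppose the curve stays inside the sphere. From time \<open>t0\<close> on it lies in the compact set \<open>K\<close> of
  points of the closed disk with \<open>Re f \<le> Re f (\<Phi> t0) < Re f a\<close>. This set avoids the critical point
  \<open>a\<close>, so \<open>|f'| \<ge> m > 0\<close> on it and \<open>Re f\<close> decreases at rate at least \<open>m\<close>. Since \<open>Re f\<close> is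
  bounded below on the disk, \<open>T\<close> is finite; a curve of finite length has a limit, which lies in \<open>K\<close>
  and is therefore regular, and the curve extends past it.
\<close>
lemma steepest_descent_reaches_sphere:
  fixes f :: "complex \<Rightarrow> complex"
  assumes hol: "f holomorphic_on ball a r" and S: "ball a r \<subseteq> S"
    and u: "\<And>z. z \<in> ball a r \<Longrightarrow> u z = Re (f z)"
    and max: "maximal_steepest_descent_curve u S a v T \<Phi>"
    and \<epsilon>: "0 < \<epsilon>" "\<epsilon> < r"
    and crit: "\<And>z. z \<noteq> a \<Longrightarrow> norm (z - a) \<le> \<epsilon> \<Longrightarrow> deriv f z \<noteq> 0"
  shows "\<exists>t. 0 < t \<and> ereal t < T \<and> norm (\<Phi> t - a) = \<epsilon>"
proof (rule ccontr)
  assume no: "\<not> ?thesis"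
  define W where "W = (\<lambda>z. - cnj (deriv f z) / of_real (norm (deriv f z)))"
  have curve: "steepest_descent_curve u S a v T \<Phi>"
    using max by (simp add: maximal_steepest_descent_curve_def)
  obtain \<Phi>' where T: "0 < T" and \<Phi>0: "\<Phi> 0 = a" and c\<Phi>: "continuous_on (curve_domain T) \<Phi>"
    and d\<Phi>: "\<And>t. 0 < t \<Longrightarrow> ereal t < T \<Longrightarrow> (\<Phi> has_vector_derivative \<Phi>' t) (at t)"
    and flow: "\<And>t. 0 < t \<Longrightarrow> ereal t < T \<Longrightarrow> \<Phi> t \<in> ball a r \<Longrightarrow> deriv f (\<Phi> t) \<noteq> 0"
      "\<And>t. 0 < t \<Longrightarrow> ereal t < T \<Longrightarrow> \<Phi> t \<in> ball a r \<Longrightarrow> \<Phi>' t = W (\<Phi> t)"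
    by (rule steepest_descent_curve_holomorphic[OF hol open_ball u curve]) (auto simp: W_def)
  note sub = Icc_subset_curve_domain[of _ T]
  have inside: "norm (\<Phi> t - a) < \<epsilon>" if t: "0 \<le> t" "ereal t < T" for t
  proof (rule ccontr)
    assume "\<not> norm (\<Phi> t - a) < \<epsilon>"
    then have "\<exists>x\<ge>0. x \<le> t \<and> norm (\<Phi> x - a) = \<epsilon>"
      using \<Phi>0 \<epsilon>(1) t sub[OF t(2)]
      by (intro IVT') (auto intro!: continuous_intros intro: continuous_on_subset[OF c\<Phi>])
    then obtain x where x: "0 \<le> x" "x \<le> t" "norm (\<Phi> x - a) = \<epsilon>" by blast
    then have "x \<noteq> 0" using \<Phi>0 \<epsilon>(1) by auto
    then show False
      using no x sub[OF t(2)] by (auto simp: curve_domain_def subset_eq)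
  qed
  have in_ball: "\<Phi> t \<in> ball a r" if "0 \<le> t" "ereal t < T" for t
    using inside[OF that] \<epsilon> by (auto simp: dist_norm norm_minus_commute)
  have descent: "\<exists>x. s < x \<and> x < t \<and> Re (f (\<Phi> t)) = Re (f (\<Phi> s)) - norm (deriv f (\<Phi> x)) * (t - s)"
    if st: "0 \<le> s" "s < t" "ereal t < T" for s t
  proof (rule descent_along_curve(2)[OF hol open_ball st(2)])
    show "continuous_on {s..t} \<Phi>"
      using sub[OF st(3)] st by (intro continuous_on_subset[OF c\<Phi>]) auto
    show "\<Phi> x \<in> ball a r" if "x \<in> {s..t}" for x
      using in_ball sub[OF st(3)] that st by (auto simp: curve_domain_def subset_eq)
    show "(\<Phi> has_vector_derivative - cnj (deriv f (\<Phi> x)) / of_real (norm (deriv f (\<Phi> x)))) (at x)"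
      if "s < x" "x < t" for x
    proof -
      have x: "0 < x" "ereal x < T" using that st by (auto intro: ereal_less_trans_real)
      then show ?thesis using d\<Phi>[OF x] flow(2)[OF x in_ball] by (simp add: W_def)
    qed
  qed
  obtain t0 where t0: "0 < t0" "ereal t0 < T"
    using ereal_dense2[OF T] by (auto simp: zero_ereal_def)
  have lower: "Re (f (\<Phi> t0)) < Re (f a)"
  proof -
    obtain x where x: "0 < x" "x < t0" "Re (f (\<Phi> t0)) = Re (f a) - norm (deriv f (\<Phi> x)) * t0"
      using descent[of 0 t0] t0 \<Phi>0 by auto
    then have xT: "ereal x < T" using t0 by (auto intro: ereal_less_trans_real)
    have "norm (deriv f (\<Phi> x)) > 0"
      using flow(1)[OF x(1) xT in_ball] x xT by auto
    then show ?thesis using x t0 by simp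
  qed
  define K where "K = cball a \<epsilon> \<inter> (\<lambda>z. Re (f z)) -` {..Re (f (\<Phi> t0))}"
  have K_ball: "cball a \<epsilon> \<subseteq> ball a r" using \<epsilon> by auto
  have cf: "continuous_on (cball a \<epsilon>) (\<lambda>z. Re (f z))"
    by (intro continuous_intros continuous_on_subset[OF holomorphic_on_imp_continuous_on[OF hol] K_ball])
  have "closed K"
    unfolding K_def by (intro continuous_closed_preimage cf) auto
  then have K: "compact K"
    by (auto simp: K_def compact_eq_bounded_closed intro: bounded_subset[OF bounded_cball])
  have in_K: "\<Phi> t \<in> K" if t: "t0 \<le> t" "ereal t < T" for t
  proof (cases "t = t0")
    case False
    then have "t0 < t" using t by simp
    then obtain x where "Re (f (\<Phi> t)) = Re (f (\<Phi> t0)) - norm (deriv f (\<Phi> x)) * (t - t0)"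
      using descent[of t0 t] t t0 by auto
    then show ?thesis
      using t inside[of t] t0 by (auto simp: K_def dist_norm norm_minus_commute)
  qed (use inside[of t0] t0 in \<open>auto simp: K_def dist_norm norm_minus_commute\<close>)
  have K_reg: "z \<in> ball a r" "deriv f z \<noteq> 0" if "z \<in> K" for z
  proof -
    have "z \<noteq> a" using that lower by (auto simp: K_def)
    then show "z \<in> ball a r" "deriv f z \<noteq> 0"
      using that crit[of z] \<epsilon> by (auto simp: K_def dist_norm norm_minus_commute)
  qed
  have "continuous_on K (\<lambda>z. norm (deriv f z))"
    by (intro continuous_intros holomorphic_on_imp_continuous_on
          holomorphic_on_subset[OF holomorphic_deriv[OF hol open_ball]]) (use K_reg in auto)
  then obtain z0 where z0: "z0 \<in> K" "\<And>z. z \<in> K \<Longrightarrow> norm (deriv f z0) \<le> norm (deriv f z)"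
    using continuous_attains_inf[OF K] in_K[of t0] t0 by (metis empty_iff order_refl)
  define m where "m = norm (deriv f z0)"
  have m: "m > 0" using K_reg(2)[OF z0(1)] by (simp add: m_def)
  have "\<exists>z1\<in>cball a \<epsilon>. \<forall>z\<in>cball a \<epsilon>. Re (f z1) \<le> Re (f z)"
    by (rule continuous_attains_inf[OF compact_cball _ cf]) (use \<epsilon> in simp)
  then obtain z1 where z1: "\<And>z. z \<in> cball a \<epsilon> \<Longrightarrow> Re (f z1) \<le> Re (f z)"
    by blast
  have bounded: "t \<le> t0 + (Re (f a) - Re (f z1)) / m" if t: "t0 < t" "ereal t < T" for t
  proof -
    obtain x where x: "t0 < x" "x < t"
      "Re (f (\<Phi> t)) = Re (f (\<Phi> t0)) - norm (deriv f (\<Phi> x)) * (t - t0)"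
      using descent[of t0 t] t t0 by auto
    have "\<Phi> x \<in> K" using x t by (intro in_K) (auto intro: ereal_less_trans_real)
    then have "m * (t - t0) \<le> norm (deriv f (\<Phi> x)) * (t - t0)"
      using z0(2) t by (intro mult_right_mono) (auto simp: m_def)
    also have "\<dots> \<le> Re (f a) - Re (f z1)"
      using x(3) lower z1[of "\<Phi> t"] inside[of t] t t0 by (auto simp: dist_norm norm_minus_commute)
    finally show ?thesis using m by (simp add: field_simps)
  qed
  have "T \<noteq> \<infinity>"
  proof
    assume "T = \<infinity>"
    define q where "q = (Re (f a) - Re (f z1)) / m"
    have "t0 + \<bar>q\<bar> + 1 \<le> t0 + q"
      by (rule bounded[folded q_def]) (auto simp: \<open>T = \<infinity>\<close>)
    then show False
      using abs_ge_self[of q] by linarith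
  qed
  then obtain T1 where T1: "T = ereal T1" using T by (cases T) auto
  have T1_pos: "0 < T1" "t0 < T1" using T t0 T1 by auto
  have "norm (\<Phi> s - \<Phi> t) \<le> 1 * norm (s - t)" if "s \<in> {0<..<T1}" "t \<in> {0<..<T1}" for s t
  proof (rule differentiable_bound[of "{0<..<T1}" \<Phi> "\<lambda>x h. h *\<^sub>R \<Phi>' x"])
    fix x assume x: "x \<in> {0<..<T1}"
    then show "(\<Phi> has_derivative (\<lambda>h. h *\<^sub>R \<Phi>' x)) (at x within {0<..<T1})"
      using d\<Phi>[of x] T1 unfolding has_vector_derivative_def by (auto intro: has_derivative_at_withinI)
    have "norm (\<Phi>' x) \<le> 1"
      using flow(2)[of x] in_ball[of x] x T1 by (auto simp: W_def norm_divide)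
    then show "onorm (\<lambda>h. h *\<^sub>R \<Phi>' x) \<le> 1"
      by (intro onorm_le) (simp add: mult_left_le)
  qed (use that in auto)
  then have "uniformly_continuous_on {0<..<T1} \<Phi>"
    by (intro lipschitz_on_uniformly_continuous[of 1] lipschitz_onI) (auto simp: dist_norm)
  moreover have "T1 \<in> closure {0<..<T1}" using T1_pos by simp
  ultimately obtain p where "(\<Phi> \<longlongrightarrow> p) (at T1 within {0<..<T1})"
    using uniformly_continuous_on_extension_at_closure by blast
  moreover have "at T1 within {0<..<T1} = at_left T1"
    using T1_pos by (intro at_within_nhd[of _ "{0<..}"]) auto
  ultimately have lim: "(\<Phi> \<longlongrightarrow> p) (at_left T1)" by simp
  have "\<forall>\<^sub>F t in at_left T1. \<Phi> t \<in> K"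
    using eventually_at_left_real[OF T1_pos(2)] by eventually_elim (use in_K T1 in auto)
  then have "p \<in> K"
    using Lim_in_closed_set[OF \<open>closed K\<close> _ _ lim] by simp
  obtain T' \<Psi> where \<Psi>: "T1 < T'" "steepest_descent_curve u S a v (ereal T') \<Psi>"
      "\<And>t. t < T1 \<Longrightarrow> \<Psi> t = \<Phi> t"
    by (rule steepest_descent_curve_extends[OF hol open_ball S u curve[unfolded T1] _ lim K_reg(1)[OF \<open>p \<in> K\<close>] K_reg(2)[OF \<open>p \<in> K\<close>]])
      (use in_ball T1 in auto)
  have "ereal T' = T"
  proof -
    have "T \<le> ereal T'" "\<forall>t\<in>curve_domain T. \<Psi> t = \<Phi> t"
      using \<Psi>(1,3) by (auto simp: T1 curve_domain_def)
    then show ?thesis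
      using max \<Psi>(2) unfolding maximal_steepest_descent_curve_def by blast
  qed
  then show False using \<Psi>(1) T1 by simp
qed

text \<open>
  Up to its first exit from the disk of radius \<open>\<epsilon>\<close> the curve lies where \<open>f\<close> is holomorphic, so
  \<open>f\<close> changes only by a real decrease, and integrals along the curve depend only on its endpoint.
\<close>
lemma steepest_descent_first_exit:
  fixes f :: "complex \<Rightarrow> complex"
  assumes hol: "f holomorphic_on ball a r" and S: "ball a r \<subseteq> S"
    and u: "\<And>z. z \<in> ball a r \<Longrightarrow> u z = Re (f z)"
    and max: "maximal_steepest_descent_curve u S a v T \<Phi>"
    and \<epsilon>: "0 < \<epsilon>" "\<epsilon> < r"
    and crit: "\<And>z. z \<noteq> a \<Longrightarrow> norm (z - a) \<le> \<epsilon> \<Longrightarrow> deriv f z \<noteq> 0"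
    and \<tau>: "\<tau> = Inf {t. 0 < t \<and> ereal t < T \<and> norm (\<Phi> t - a) = \<epsilon>}"
  shows "norm (\<Phi> \<tau> - a) = \<epsilon>"
    and "Im (f (\<Phi> \<tau>)) = Im (f a)" and "Re (f (\<Phi> \<tau>)) \<le> Re (f a)"
    and "\<And>G g. (\<And>z. z \<in> ball a r \<Longrightarrow> (G has_field_derivative g z) (at z)) \<Longrightarrow>
           contour_integral (\<lambda>s. \<Phi> (\<tau> * s)) g = G (\<Phi> \<tau>) - G a"
proof -
  define W where "W = (\<lambda>z. - cnj (deriv f z) / of_real (norm (deriv f z)))"
  have curve: "steepest_descent_curve u S a v T \<Phi>"
    using max by (simp add: maximal_steepest_descent_curve_def)
  obtain \<Phi>' where T: "0 < T" and \<Phi>0: "\<Phi> 0 = a" and c\<Phi>: "continuous_on (curve_domain T) \<Phi>"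
    and c\<Phi>': "continuous_on (curve_domain T) \<Phi>'"
    and d\<Phi>: "\<And>t. 0 < t \<Longrightarrow> ereal t < T \<Longrightarrow> (\<Phi> has_vector_derivative \<Phi>' t) (at t)"
    and flow: "\<And>t. 0 < t \<Longrightarrow> ereal t < T \<Longrightarrow> \<Phi> t \<in> ball a r \<Longrightarrow> \<Phi>' t = W (\<Phi> t)"
    by (rule steepest_descent_curve_holomorphic[OF hol open_ball u curve]) (auto simp: W_def)
  define E where "E = {t. 0 < t \<and> ereal t < T \<and> norm (\<Phi> t - a) = \<epsilon>}"
  obtain t1 where t1: "t1 \<in> E"
    using steepest_descent_reaches_sphere[OF hol S u max \<epsilon> crit] by (auto simp: E_def)
  note sub = Icc_subset_curve_domain[of _ T]
  have sub1: "{0..t1} \<subseteq> curve_domain T" using sub t1 by (auto simp: E_def)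
  have E1: "{t\<in>{0..t1}. norm (\<Phi> t - a) = \<epsilon>} = E \<inter> {..t1}"
    using sub1 \<Phi>0 \<epsilon>(1) by (auto simp: E_def curve_domain_def subset_eq less_eq_real_def)
  have "closed {t\<in>{0..t1}. norm (\<Phi> t - a) = \<epsilon>}"
    by (intro continuous_closed_preimage_constant continuous_intros continuous_on_subset[OF c\<Phi> sub1])
  then have "closed (E \<inter> {..t1})" unfolding E1 .
  moreover have bdd: "bdd_below E" by (rule bdd_belowI[of _ 0]) (auto simp: E_def)
  \<comment> \<open>\<open>E\<close> itself need not be closed, because \<open>\<Phi>\<close> is uncontrolled near \<open>T\<close>\<close>
  moreover have InfE: "Inf E = Inf (E \<inter> {..t1})"
  proof (rule antisym)
    show "Inf E \<le> Inf (E \<inter> {..t1})"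
      using t1 bdd by (intro cInf_superset_mono) auto
    have bdd1: "bdd_below (E \<inter> {..t1})" by (rule bdd_below_mono[OF bdd]) auto
    show "Inf (E \<inter> {..t1}) \<le> Inf E"
    proof (rule cInf_greatest)
      show "E \<noteq> {}" using t1 by auto
      fix x assume "x \<in> E"
      then show "Inf (E \<inter> {..t1}) \<le> x"
        using cInf_lower[OF _ bdd1, of x] cInf_lower[OF _ bdd1, of t1] t1 by (cases "x \<le> t1") auto
    qed
  qed
  ultimately have "Inf E \<in> E"
    using closed_contains_Inf[of "E \<inter> {..t1}"] t1 bdd by (auto intro: bdd_below_mono[OF bdd])
  then have \<tau>E: "\<tau> \<in> E" by (simp add: \<tau> E_def)
  then have \<tau>_pos: "0 < \<tau>" and \<tau>T: "ereal \<tau> < T" and \<tau>\<epsilon>: "norm (\<Phi> \<tau> - a) = \<epsilon>" by (auto simp: E_def)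
  show "norm (\<Phi> \<tau> - a) = \<epsilon>" by (rule \<tau>\<epsilon>)
  have sub\<tau>: "{0..\<tau>} \<subseteq> curve_domain T" using sub[OF \<tau>T] .
  have c\<tau>: "continuous_on {0..\<tau>} \<Phi>" by (rule continuous_on_subset[OF c\<Phi> sub\<tau>])
  have inside: "norm (\<Phi> t - a) \<le> \<epsilon>" if t: "t \<in> {0..\<tau>}" for t
  proof (rule ccontr)
    assume gt: "\<not> norm (\<Phi> t - a) \<le> \<epsilon>"
    then have "\<exists>x\<ge>0. x \<le> t \<and> norm (\<Phi> x - a) = \<epsilon>"
      using \<Phi>0 \<epsilon>(1) t
      by (intro IVT') (auto intro!: continuous_intros intro: continuous_on_subset[OF c\<tau>])
    then obtain x where x: "0 \<le> x" "x \<le> t" "norm (\<Phi> x - a) = \<epsilon>" by blast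
    then have "x \<noteq> 0" "x \<noteq> t" using \<Phi>0 \<epsilon>(1) gt by auto
    moreover have "ereal x < T" using x t sub\<tau> by (auto simp: curve_domain_def subset_eq)
    ultimately have "x \<in> E" using x by (auto simp: E_def)
    then have "\<tau> \<le> x" using cInf_lower[OF _ bdd] by (auto simp: \<tau> E_def)
    then show False using x t \<open>x \<noteq> t\<close> by auto
  qed
  have in_ball: "\<Phi> t \<in> ball a r" if "t \<in> {0..\<tau>}" for t
    using inside[OF that] \<epsilon> by (auto simp: dist_norm norm_minus_commute)
  have flow': "(\<Phi> has_vector_derivative - cnj (deriv f (\<Phi> x)) / of_real (norm (deriv f (\<Phi> x)))) (at x)"
    if "0 < x" "x < \<tau>" for x
  proof -
    have x: "ereal x < T" using that \<tau>T by (auto intro: ereal_less_trans_real)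
    then show ?thesis using d\<Phi>[OF that(1) x] flow[OF that(1) x] in_ball[of x] that by (simp add: W_def)
  qed
  note descent = descent_along_curve[OF hol open_ball \<tau>_pos c\<tau> in_ball flow']
  show "Im (f (\<Phi> \<tau>)) = Im (f a)" using descent(1) \<Phi>0 by simp
  show "Re (f (\<Phi> \<tau>)) \<le> Re (f a)" using descent(2) \<Phi>0 \<tau>_pos by auto
  fix G g assume G: "\<And>z. z \<in> ball a r \<Longrightarrow> (G has_field_derivative g z) (at z)"
  have scale: "\<tau> * s \<in> {0..\<tau>}" if "s \<in> {0..1}" for s
    using that \<tau>_pos by (auto simp: mult_left_le)
  have "valid_path (\<lambda>s. \<Phi> (\<tau> * s))"
    unfolding valid_path_def piecewise_C1_differentiable_on_def
  \<comment> \<open>at \<open>0\<close> the curve is only known to have a one-sided derivative\<close>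
  proof (intro conjI exI[of _ "{0}"])
    show "continuous_on {0..1} (\<lambda>s. \<Phi> (\<tau> * s))"
      by (rule continuous_on_compose2[OF c\<tau>]) (use scale in \<open>auto intro!: continuous_intros\<close>)
    have d: "((\<lambda>s. \<Phi> (\<tau> * s)) has_vector_derivative \<tau> *\<^sub>R \<Phi>' (\<tau> * s)) (at s)" if s: "s \<in> {0..1} - {0}" for s
    proof -
      have "((\<lambda>s. \<tau> * s) has_vector_derivative \<tau>) (at s)"
        by (auto intro!: derivative_eq_intros)
      moreover have "(\<Phi> has_vector_derivative \<Phi>' (\<tau> * s)) (at (\<tau> * s))"
        using scale[of s] s \<tau>_pos sub\<tau> by (intro d\<Phi>) (auto simp: curve_domain_def subset_eq)
      ultimately show ?thesis
        using vector_diff_chain_at by (fastforce simp: o_def)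
    qed
    have "(\<lambda>s. \<tau> * s) ` ({0..1} - {0}) \<subseteq> curve_domain T"
      using scale sub\<tau> by blast
    then have c: "continuous_on ({0..1} - {0}) (\<lambda>s. \<tau> *\<^sub>R \<Phi>' (\<tau> * s))"
      by (intro continuous_intros continuous_on_compose2[OF c\<Phi>'])
    show "(\<lambda>s. \<Phi> (\<tau> * s)) C1_differentiable_on {0..1} - {0}"
      unfolding C1_differentiable_on_def by (intro exI conjI ballI) (rule d, assumption, rule c)
  qed simp
  moreover have "path_image (\<lambda>s. \<Phi> (\<tau> * s)) \<subseteq> ball a r"
    using scale in_ball unfolding path_image_def by blast
  moreover have "(G has_field_derivative g z) (at z within ball a r)" if "z \<in> ball a r" for z
    using G[OF that] by (rule has_field_derivative_at_within)
  ultimately have "(g has_contour_integral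
      (G (pathfinish (\<lambda>s. \<Phi> (\<tau> * s))) - G (pathstart (\<lambda>s. \<Phi> (\<tau> * s))))) (\<lambda>s. \<Phi> (\<tau> * s))"
    by (intro contour_integral_primitive[of "ball a r"])
  then show "contour_integral (\<lambda>s. \<Phi> (\<tau> * s)) g = G (\<Phi> \<tau>) - G a"
    by (simp add: contour_integral_unique pathstart_def pathfinish_def \<Phi>0)
qed

text \<open>
  A nonpositive real \<open>Y\<close> within \<open>X / 1024\<close> of \<open>X \<omega>\<close> has modulus at least \<open>X - X / 1024\<close>, so
  \<open>\<omega>\<close> is close to \<open>- 1\<close>. Applied with \<open>Y = f p - f a\<close> and \<open>X = N\<^sup>n \<epsilon>\<^sup>n\<close>, where \<open>p\<close> is the exit
  point of the curve, this is what makes the integrand decay along the segment to \<open>p\<close>.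
\<close>
lemma descent_direction_estimate:
  fixes Y \<omega> :: complex and X :: real
  assumes Y: "Im Y = 0" "Re Y \<le> 0" and X: "X > 0" and \<omega>: "norm \<omega> = 1"
    and close: "norm (Y - of_real X * \<omega>) \<le> X / 1024"
  shows "Re \<omega> \<le> - (511 / 512)"
proof -
  have "X = norm (of_real X * \<omega>)"
    using X \<omega> by (simp add: norm_mult)
  also have "\<dots> \<le> norm Y + norm (Y - of_real X * \<omega>)"
    by (metis norm_minus_commute norm_triangle_sub)
  also have "norm Y = - Re Y"
    using Y by (simp add: cmod_eq_Re)
  finally have "Re Y \<le> - X + X / 1024"
    using close by simp
  moreover have "X * Re \<omega> - Re Y \<le> X / 1024"
    using abs_Re_le_cmod[of "Y - of_real X * \<omega>"] close by simp
  ultimately have "X * Re \<omega> \<le> X * - (511 / 512)"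
    by simp
  then show ?thesis using X by (simp only: mult_le_cancel_left_pos)
qed


section \<open>Comparison of Laplace-type integrals\<close>

lemma exp_ge_twice: "2 * y \<le> exp (y::real)"
proof (cases "y \<ge> 0")
  case True
  have "2 * y \<le> exp 1 * y"
    using True exp_ge_add_one_self[of "1::real"] by (intro mult_right_mono) auto
  also have "\<dots> \<le> exp 1 * exp (y - 1)"
    using exp_ge_add_one_self[of "y - 1"] by (intro mult_left_mono) auto
  finally show ?thesis
    by (simp add: exp_add[symmetric])
next
  case False
  then have "2 * y < 0" by simp
  then show ?thesis using exp_gt_zero[of y] by linarith
qed

lemma one_plus_square_le:
  fixes x :: real
  assumes "n \<ge> 1" "1 \<le> x"
  shows "1 + x\<^sup>2 \<le> 2 * (x ^ n)\<^sup>2"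
proof -
  have "x ^ 1 \<le> x ^ n"
    using assms by (intro power_increasing) auto
  then have "x\<^sup>2 \<le> (x ^ n)\<^sup>2"
    using assms by (intro power_mono) auto
  moreover have "1 \<le> (x ^ n)\<^sup>2"
    using assms by (simp add: one_le_power)
  ultimately show ?thesis by simp
qed

text \<open>
  The multiple of \<open>1 / (1 + x\<^sup>2)\<close> on the right is a dominating function that serves all \<open>n\<close> and \<open>m\<close>
  at once and whose integral is elementary. For \<open>x \<ge> 1\<close> everything is expressed by \<open>U = x\<^sup>n \<ge> x\<close>,
  which leaves the bound of \<open>U\<^sup>4\<close> by a multiple of \<open>exp (14 U / 15)\<close>.
\<close>
lemma power_times_exp_le_Cauchy_density:
  fixes x :: real
  assumes n: "n \<ge> 1" and m: "m \<le> n + 1" and x: "x \<ge> 0"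
  shows "x ^ m * exp (- (14 / 15 * x ^ n)) \<le> 64 / (1 + x\<^sup>2)"
proof -
  have "(1 + x\<^sup>2) * (x ^ m * exp (- (14 / 15 * x ^ n))) \<le> 64"
  proof (cases "x \<le> 1")
    case True
    then have "(1 + x\<^sup>2) * (x ^ m * exp (- (14 / 15 * x ^ n))) \<le> (1 + 1) * (1 * 1)"
      using x by (intro mult_mono add_left_mono power_le_one) (auto intro: power_le_one)
    then show ?thesis by simp
  next
    case False
    define U where "U = x ^ n"
    have U: "U \<ge> 1" using False by (simp add: U_def one_le_power)
    have "x ^ m \<le> x ^ (n + n)"
      using False m n by (intro power_increasing) auto
    then have m': "x ^ m \<le> U\<^sup>2"
      by (simp add: U_def power_add power2_eq_square)
    have "(7 / 15 * U) ^ 4 \<le> exp (7 / 30 * U) ^ 4"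
      using exp_ge_twice[of "7 / 30 * U"] U by (intro power_mono) auto
    also have "\<dots> = exp (14 / 15 * U)"
      by (simp add: exp_of_nat_mult[symmetric])
    finally have "2401 / 50625 * U ^ 4 \<le> exp (14 / 15 * U)"
      by (simp add: power_mult_distrib power_divide)
    then have e: "2 * U ^ 4 \<le> 64 * exp (14 / 15 * U)"
      using exp_gt_zero[of "14 / 15 * U"] by linarith
    have "(1 + x\<^sup>2) * (x ^ m * exp (- (14 / 15 * x ^ n))) \<le> (2 * U\<^sup>2) * (U\<^sup>2 * exp (- (14 / 15 * U)))"
      using one_plus_square_le[OF n, of x] False m' x
      by (intro mult_mono) (auto simp: U_def)
    also have "\<dots> = 2 * U ^ 4 / exp (14 / 15 * U)"
      by (simp add: exp_minus field_simps power2_eq_square power4_eq_xxxx)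
    also have "\<dots> \<le> 64"
      using e by (simp add: field_simps)
    finally show ?thesis .
  qed
  then show ?thesis
    by (simp add: pos_le_divide_eq add_pos_nonneg mult.commute)
qed

lemma exp_le_Cauchy_density:
  fixes x :: real
  assumes n: "n \<ge> 1" and x: "x \<ge> 0"
  shows "exp (- (2 / 3 * x ^ n)) \<le> 64 / (1 + x\<^sup>2)"
proof -
  have "(1 + x\<^sup>2) * exp (- (2 / 3 * x ^ n)) \<le> 64"
  proof (cases "x \<le> 1")
    case True
    then have "(1 + x\<^sup>2) * exp (- (2 / 3 * x ^ n)) \<le> (1 + 1) * 1"
      using x by (intro mult_mono add_left_mono power_le_one) auto
    then show ?thesis by simp
  next
    case False
    define U where "U = x ^ n"
    have U: "U \<ge> 1" using False by (simp add: U_def one_le_power)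
    have "(2 / 3 * U) ^ 2 \<le> exp (U / 3) ^ 2"
      using exp_ge_twice[of "U / 3"] U by (intro power_mono) auto
    also have "\<dots> = exp (2 / 3 * U)"
      by (simp add: exp_of_nat_mult[symmetric])
    finally have "4 / 9 * U ^ 2 \<le> exp (2 / 3 * U)"
      by (simp add: power_mult_distrib power_divide)
    then have e: "2 * U ^ 2 \<le> 64 * exp (2 / 3 * U)"
      using exp_gt_zero[of "2 / 3 * U"] by linarith
    have "(1 + x\<^sup>2) * exp (- (2 / 3 * x ^ n)) \<le> (2 * U\<^sup>2) * exp (- (2 / 3 * U))"
      using one_plus_square_le[OF n, of x] False x
      by (intro mult_mono) (auto simp: U_def)
    also have "\<dots> = 2 * U ^ 2 / exp (2 / 3 * U)"
      by (simp add: exp_minus field_simps)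
    also have "\<dots> \<le> 64"
      using e by (simp add: field_simps)
    finally show ?thesis .
  qed
  then show ?thesis
    by (simp add: pos_le_divide_eq add_pos_nonneg mult.commute)
qed

lemma Cauchy_density_half_line:
  shows "set_integrable lborel {0..} (\<lambda>x::real. 1 / (1 + x\<^sup>2))"
    and "(LINT x:{0..}|lborel. 1 / (1 + x\<^sup>2)) = pi / 2"
proof -
  have nn: "(\<integral>\<^sup>+x. ennreal (1 / (1 + x\<^sup>2)) * indicator {0..} x \<partial>lborel) = ennreal (pi / 2 - arctan 0)"
    by (rule nn_integral_FTC_atLeast)
      (auto intro!: derivative_eq_intros tendsto_arctan_at_top simp: field_simps)
  have "(\<integral>\<^sup>+x. ennreal (indicator {0..} x *\<^sub>R (1 / (1 + x\<^sup>2))) \<partial>lborel) = ennreal (pi / 2)"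
    by (subst nn[symmetric, simplified]) (auto intro!: nn_integral_cong simp: indicator_def)
  then have "has_bochner_integral lborel (\<lambda>x::real. indicator {0..} x *\<^sub>R (1 / (1 + x\<^sup>2))) (pi / 2)"
    by (intro has_bochner_integral_nn_integral) (auto simp: indicator_def)
  then show "set_integrable lborel {0..} (\<lambda>x::real. 1 / (1 + x\<^sup>2))"
    and "(LINT x:{0..}|lborel. 1 / (1 + x\<^sup>2)) = pi / 2"
    by (simp_all add: has_bochner_integral_iff set_integrable_def set_lebesgue_integral_def)
qed

lemma norm_exp_minus_1_le: "norm (exp z - 1) \<le> norm z * exp (norm z)" for z :: complex
proof -
  have "norm (exp z - 1) \<le> exp \<bar>Re z\<bar> * norm z"
    using Taylor_exp[of z 0] by simp
  also have "\<dots> \<le> exp (norm z) * norm z"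
    using abs_Re_le_cmod[of z] by (intro mult_right_mono) auto
  finally show ?thesis by (simp add: mult.commute)
qed

text \<open>
  Young's inequality for the exponents \<open>p = n / k\<close> and \<open>q = n / (n - k)\<close>. The weight \<open>l\<close> is chosen
  such that \<open>(l x\<^sup>k)\<^sup>p / p = x\<^sup>n / 16\<close>.
\<close>
lemma Young_power:
  fixes b x :: real
  assumes k: "1 \<le> k" "k < n" and b: "b > 0" and x: "x \<ge> 0"
  shows "b * x ^ k \<le> x ^ n / 16 +
    b powr (n / (real n - real k)) * (16 * real k / real n) powr (k / (real n - real k))"
proof (cases "x = 0")
  case True
  then show ?thesis using k by (simp add: power_0_left)
next
  case False
  then have x: "x > 0" using assms by simp
  define p q where "p = real n / real k" and "q = real n / (real n - real k)"
  define l where "l = (real n / (16 * real k)) powr (1 / p)"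
  have pq: "p > 1" "q > 1" "1 / p + 1 / q = 1"
    using k by (auto simp: p_def q_def field_simps)
  have l: "l > 0" using k by (simp add: l_def)
  have "b * x ^ k = (l * x ^ k) * (b / l)"
    using l by simp
  also have "\<dots> \<le> (l * x ^ k) powr p / p + (b / l) powr q / q"
    using pq l b x by (intro Youngs_inequality) auto
  also have "(l * x ^ k) powr p / p = x ^ n / 16"
  proof -
    have "(x ^ k) powr p = x ^ n"
      using x k by (simp add: powr_realpow[symmetric] powr_powr p_def)
    moreover have "l powr p = real n / (16 * real k)"
      using k pq by (simp add: l_def powr_powr)
    ultimately show ?thesis
      using k x l by (simp add: powr_mult p_def)
  qed
  also have "(b / l) powr q / q \<le> b powr q * (16 * real k / real n) powr (k / (real n - real k))"
  proof -
    have "q / p = k / (real n - real k)"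
      using k by (simp add: p_def q_def)
    moreover have "1 / l = (16 * real k / real n) powr (1 / p)"
      using k by (simp add: l_def powr_divide)
    then have "(1 / l) powr q = (16 * real k / real n) powr (q / p)"
      by (simp add: powr_powr)
    ultimately have "(1 / l) powr q = (16 * real k / real n) powr (k / (real n - real k))"
      by simp
    then have "(b / l) powr q = b powr q * (16 * real k / real n) powr (k / (real n - real k))"
      using b l powr_mult[of b "1 / l" q] by simp
    moreover have "y / q \<le> y" if "y \<ge> 0" for y
      using pq that mult_right_mono[of 1 q y] by (simp add: field_simps)
    ultimately show ?thesis by simp
  qed
  finally show ?thesis by (simp add: q_def)
qed

text \<open>
  Both integrals are written over the half line, with the first integrand cut off at \<open>L\<close>, and the
  difference of the integrands is dominated by \<open>D / (1 + x\<^sup>2)\<close>. Up to \<open>L\<close> the factor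
  \<open>exp (g x) - 1\<close> supplies \<open>1 / N\<close>; beyond \<open>L\<close> a quarter of the exponent is spent on
  \<open>exp (- L\<^sup>n / 4)\<close>. In both cases at least \<open>14 / 15\<close> respectively \<open>2 / 3\<close> of \<open>x\<^sup>n\<close> is left to
  ensure integrability.
\<close>
lemma Laplace_comparison:
  fixes \<omega> \<delta> \<theta> :: complex and g :: "real \<Rightarrow> complex" and L N E K1 K2 :: real
  assumes n: "n \<ge> 1" and k: "k \<le> n" and pos: "N > 0" "L \<ge> 0" "K1 \<ge> 0" "K2 \<ge> 0"
    and \<theta>: "norm \<theta> = 1" and \<omega>: "Re \<omega> \<le> - (511 / 512)"
    and cont: "continuous_on {0..L} g"
    and small: "\<And>x. 0 \<le> x \<Longrightarrow> x \<le> L \<Longrightarrow> norm (g x) \<le> x ^ n / 1024 + norm \<delta> * x ^ k / 8"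
    and remainder: "\<And>x. 0 \<le> x \<Longrightarrow> x \<le> L \<Longrightarrow>
          norm (g x) \<le> 2 / N * (K1 * x ^ (n + 1) + K2 * x ^ (k + 1))"
    and E: "\<And>x. 0 \<le> x \<Longrightarrow> 9 / 8 * norm \<delta> * x ^ k \<le> x ^ n / 16 + E"
  shows "norm ((LINT x:{0..L}|lborel. \<theta> * exp (\<omega> * of_real x ^ n + \<delta> * of_real x ^ k + g x))
             - (LINT x:{0..}|lborel. \<theta> * exp (\<omega> * of_real x ^ n + \<delta> * of_real x ^ k)))
         \<le> 256 * (K1 + K2 + 1) * exp E * (1 / N + exp (- (L ^ n / 4)))"
proof -
  define A where "A = (\<lambda>x::real. \<theta> * exp (\<omega> * of_real x ^ n + \<delta> * of_real x ^ k + g x))"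
  define G where "G = (\<lambda>x::real. \<theta> * exp (\<omega> * of_real x ^ n + \<delta> * of_real x ^ k))"
  define h where "h = (\<lambda>x::real. 1 / (1 + x\<^sup>2))"
  define D where "D = 128 * (K1 + K2 + 1) * exp E * (1 / N + exp (- (L ^ n / 4)))"
  have h0: "h x \<ge> 0" for x by (simp add: h_def)
  have D0: "D \<ge> 0" using pos by (simp add: D_def)
  have G_le: "norm (G x) \<le> exp (- (511 / 512 * x ^ n) + norm \<delta> * x ^ k)" if x: "x \<ge> 0" for x
  proof -
    have "Re (\<omega> * of_real x ^ n) \<le> - (511 / 512) * x ^ n"
      using mult_right_mono[OF \<omega>, of "x ^ n"] x by (simp flip: of_real_power)
    moreover have "Re (\<delta> * of_real x ^ k) \<le> norm \<delta> * x ^ k"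
      using complex_Re_le_cmod[of "\<delta> * of_real x ^ k"] x by (simp add: norm_mult norm_power)
    ultimately show ?thesis
      by (simp add: G_def norm_mult \<theta>)
  qed
  have G_bound: "norm (G x) \<le> exp E * exp (- (479 / 512 * x ^ n))" if x: "x \<ge> 0" for x
  proof -
    have "- (511 / 512 * x ^ n) + norm \<delta> * x ^ k \<le> E + - (479 / 512 * x ^ n)"
      using E[OF x] mult_nonneg_nonneg[OF norm_ge_zero[of \<delta>] zero_le_power[OF x, of k]] by linarith
    then show ?thesis
      by (intro order_trans[OF G_le[OF x]]) (simp add: exp_add[symmetric])
  qed
  have G_h: "norm (G x) \<le> 64 * exp E * h x" if x: "x \<ge> 0" for x
  proof -
    have "exp (- (479 / 512 * x ^ n)) \<le> exp (- (2 / 3 * x ^ n))"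
      using x by simp
    also have "\<dots> \<le> 64 * h x"
      using exp_le_Cauchy_density[OF n x] by (simp add: h_def)
    finally have "exp E * exp (- (479 / 512 * x ^ n)) \<le> exp E * (64 * h x)"
      by simp
    then show ?thesis using G_bound[OF x] by linarith
  qed
  have h_int: "set_integrable lborel {0..} h"
    unfolding h_def by (rule Cauchy_density_half_line)
  have G_int: "set_integrable lborel {0..} G"
  proof (rule set_integrable_bound)
    show "set_integrable lborel {0..} (\<lambda>x. 64 * exp E * h x)"
      using h_int by (intro set_integrable_mult_right) auto
    show "set_borel_measurable lborel {0..} G"
      unfolding set_borel_measurable_def G_def by measurable
    show "AE x in lborel. x \<in> {0..} \<longrightarrow> norm (G x) \<le> norm (64 * exp E * h x)"
      using G_h by (auto intro!: AE_I2 order_trans[OF G_h])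
  qed
  have A_int: "set_integrable lborel {0..L} A"
    unfolding A_def by (intro borel_integrable_atLeastAtMost' continuous_intros cont)
  have pointwise: "norm (indicator {0..L} x *\<^sub>R A x - indicator {0..} x *\<^sub>R G x)
      \<le> indicator {0..} x *\<^sub>R (D * h x)" for x
  proof -
    consider "x < 0" | "0 \<le> x" "x \<le> L" | "x > L" "x \<ge> 0" by linarith
    then show ?thesis
    proof cases
      case 1
      then show ?thesis by simp
    next
      case 2
      have xx: "0 \<le> x ^ n" "0 \<le> norm \<delta> * x ^ k" using 2 by auto
      have "norm (A x - G x) = norm (G x) * norm (exp (g x) - 1)"
        by (simp add: A_def G_def exp_add norm_mult[symmetric] algebra_simps)
      also have "\<dots> \<le> exp (- (511 / 512 * x ^ n) + norm \<delta> * x ^ k) * (norm (g x) * exp (norm (g x)))"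
        using G_le[OF 2(1)] norm_exp_minus_1_le by (intro mult_mono) auto
      also have "\<dots> = exp (- (511 / 512 * x ^ n) + norm \<delta> * x ^ k + norm (g x)) * norm (g x)"
        by (simp add: exp_add)
      also have "\<dots> \<le> exp (E + - (14 / 15 * x ^ n)) * (2 / N * (K1 * x ^ (n + 1) + K2 * x ^ (k + 1)))"
      proof (intro mult_mono)
        show "exp (- (511 / 512 * x ^ n) + norm \<delta> * x ^ k + norm (g x)) \<le> exp (E + - (14 / 15 * x ^ n))"
          using small[OF 2] E[OF 2(1)] xx by (intro iffD2[OF exp_le_cancel_iff]) linarith
      qed (use remainder[OF 2] in auto)
      also have "\<dots> = 2 / N * exp E * (K1 * (x ^ (n + 1) * exp (- (14 / 15 * x ^ n)))
                                     + K2 * (x ^ (k + 1) * exp (- (14 / 15 * x ^ n))))"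
        by (simp only: exp_add) (simp add: algebra_simps)
      also have "\<dots> \<le> 2 / N * exp E * (K1 * (64 * h x) + K2 * (64 * h x))"
        using power_times_exp_le_Cauchy_density[OF n _ 2(1), of "n + 1"]
          power_times_exp_le_Cauchy_density[OF n _ 2(1), of "k + 1"] k pos
        by (intro mult_left_mono add_mono) (auto simp: h_def)
      also have "\<dots> = 128 * (K1 + K2) * exp E * (1 / N) * h x"
        by (simp add: field_simps)
      also have "\<dots> \<le> D * h x"
        unfolding D_def using pos h0 by (intro mult_right_mono mult_mono) auto
      finally show ?thesis using 2 by simp
    next
      case 3
      have "L ^ n \<le> x ^ n"
        using 3 pos by (intro power_mono) auto
      then have "- (479 / 512 * x ^ n) \<le> - (L ^ n / 4) + - (2 / 3 * x ^ n)"
        using zero_le_power[OF 3(2), of n] by linarith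
      then have "exp (- (479 / 512 * x ^ n)) \<le> exp (- (L ^ n / 4)) * exp (- (2 / 3 * x ^ n))"
        by (simp add: exp_add[symmetric])
      also have "\<dots> \<le> exp (- (L ^ n / 4)) * (64 * h x)"
        using exp_le_Cauchy_density[OF n 3(2)] by (intro mult_left_mono) (auto simp: h_def)
      finally have "norm (G x) \<le> exp E * (exp (- (L ^ n / 4)) * (64 * h x))"
        by (intro order_trans[OF G_bound[OF 3(2)]]) simp
      also have "\<dots> = 64 * 1 * exp E * exp (- (L ^ n / 4)) * h x"
        by (simp add: mult_ac)
      also have "\<dots> \<le> D * h x"
        unfolding D_def using pos h0 by (intro mult_right_mono mult_mono) auto
      finally show ?thesis using 3 by simp
    qed
  qed
  have "(LINT x:{0..L}|lborel. A x) - (LINT x:{0..}|lborel. G x)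
      = integral\<^sup>L lborel (\<lambda>x. indicator {0..L} x *\<^sub>R A x - indicator {0..} x *\<^sub>R G x)"
    using A_int G_int unfolding set_lebesgue_integral_def set_integrable_def by simp
  also have "norm \<dots> \<le> integral\<^sup>L lborel (\<lambda>x. norm (indicator {0..L} x *\<^sub>R A x - indicator {0..} x *\<^sub>R G x))"
    by (rule integral_norm_bound)
  also have "\<dots> \<le> integral\<^sup>L lborel (\<lambda>x. indicator {0..} x *\<^sub>R (D * h x))"
  proof (rule integral_mono)
    show "integrable lborel (\<lambda>x. norm (indicator {0..L} x *\<^sub>R A x - indicator {0..} x *\<^sub>R G x))"
      using A_int G_int unfolding set_integrable_def by auto
    show "integrable lborel (\<lambda>x. indicator {0..} x *\<^sub>R (D * h x))"
      using set_integrable_mult_right[OF h_int, of D] D0 unfolding set_integrable_def by auto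
  qed (use pointwise in auto)
  also have "\<dots> = (LINT x:{0..}|lborel. D * h x)"
    unfolding set_lebesgue_integral_def ..
  also have "\<dots> = D * (LINT x:{0..}|lborel. h x)"
    by (rule set_integral_mult_right)
  also have "\<dots> = D * (pi / 2)"
    unfolding h_def Cauchy_density_half_line(2) ..
  also have "\<dots> \<le> D * 2"
    using D0 pi_less_4 by (intro mult_left_mono) auto
  also have "D * 2 = 256 * (K1 + K2 + 1) * exp E * (1 / N + exp (- (L ^ n / 4)))"
    by (simp add: D_def algebra_simps)
  finally show ?thesis
    by (simp only: A_def G_def)
qed


section \<open>Integrals along steepest descent curves\<close>

lemma le_SUP_compact:
  fixes h :: "'a::topological_space \<Rightarrow> real"
  assumes "compact K" "continuous_on K h" "z \<in> K"
  shows "h z \<le> (SUP z\<in>K. h z)"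
  using assms by (intro cSUP_upper bounded_imp_bdd_above compact_imp_bounded compact_continuous_image)

theorem mainTheorem11:
  fixes F f ft :: "complex \<Rightarrow> complex"
    and u ut :: "complex \<Rightarrow> real"
    and P Z S :: "complex set"
    and a c d \<rho> \<xi> \<eta> I' II :: complex
    and r N M K0 Kt0 \<epsilon>0 \<epsilon> \<tau> C :: real
    and \<epsilon>t0 T :: ereal
    and n k j :: nat
    and \<Phi> :: "real \<Rightarrow> complex"
  assumes F: "F nicely_meromorphic_on UNIV" "\<not> F constant_on UNIV"
    and P: "P = {z. is_pole F z}"
    and Z: "Z = {z. \<not> is_pole F z \<and> F z = 0}"
    and S: "S = UNIV - (P \<union> Z)"
    and harmonic: "u harmonic_on S" "ut harmonic_on S"
    and log_F: "\<And>z. z \<in> S \<Longrightarrow> ln (norm (F z)) = u z + ut z"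
    and u_nonconstant: "\<not> u constant_on S"
    and disk: "r > 0" "ball a r \<subseteq> S"
    and holomorphic: "f holomorphic_on ball a r" "ft holomorphic_on ball a r"
    and Re_f: "\<And>z. z \<in> ball a r \<Longrightarrow> Re (f z) = u z"
    and Re_ft: "\<And>z. z \<in> ball a r \<Longrightarrow> Re (ft z) = ut z"
    and F_exp: "\<And>z. z \<in> ball a r \<Longrightarrow> F z = exp (f z + ft z)"
    and n: "n \<ge> 1" "(deriv ^^ n) f a \<noteq> 0" "\<And>m. 1 \<le> m \<Longrightarrow> m < n \<Longrightarrow> (deriv ^^ m) f a = 0"
    and c: "c = (deriv ^^ n) f a / fact n"
    and root: "\<rho> ^ n = c" "\<xi> = sgn \<rho>" "N = norm \<rho>"
    and ut_nonconstant: "\<not> ut constant_on S \<Longrightarrow>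
          k \<ge> 1 \<and> (deriv ^^ k) ft a \<noteq> 0 \<and> (\<forall>m. 1 \<le> m \<longrightarrow> m < k \<longrightarrow> (deriv ^^ m) ft a = 0) \<and>
          d = (deriv ^^ k) ft a / fact k \<and>
          M = norm d powr (1 / real k) \<and>
          k < n \<and>
          Kt0 = 2 ^ (k + 1) / r ^ (k + 1) * ((SUP z\<in>cball a (r / 2). norm (ft z)) / M ^ k) \<and>
          \<epsilon>t0 = ereal (1 / (4 * Kt0))"
    and ut_constant: "ut constant_on S \<Longrightarrow>
          k = 0 \<and> d = 0 \<and> M = 0 \<and> Kt0 = 0 \<and> \<epsilon>t0 = \<infinity>"
    and K0: "K0 = 2 ^ (n + 1) / r ^ (n + 1) * (fact n / norm ((deriv ^^ n) f a)) *
          (SUP z\<in>cball a (r / 2). norm (f z) + r * norm (deriv f z))"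
    and \<epsilon>0: "\<epsilon>0 = 1 / 16 * min r (min (1 / K0) 1)"
    and \<epsilon>: "\<epsilon> > 0" "ereal \<epsilon> \<le> min (ereal (\<epsilon>0 / 128)) (min (\<epsilon>t0 / 4) (ereal (1 / (4 * real n))))"
    and j: "odd j" "j \<in> {1..n}"
    and \<Phi>: "maximal_steepest_descent_curve u S a (cnj \<xi> * cis (pi * real j / real n)) T \<Phi>"
    and \<tau>: "\<tau> = Inf {t. 0 < t \<and> ereal t < T \<and> norm (\<Phi> t - a) = \<epsilon>}"
    and \<eta>: "\<eta> = sgn (\<Phi> \<tau> - a)"
    and I': "I' = contour_integral (\<lambda>s. \<Phi> (\<tau> * s)) F"
    and II: "II = ray_integral (\<eta> * \<xi>)
          (\<lambda>w. exp (w ^ n + d / complex_of_real N ^ k * cnj \<xi> ^ k * w ^ k))"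
    and C: "C = 128 * fact (n + 1) * (K0 + Kt0 * M ^ k / N ^ k + 1) *
          exp (rpow (2 * M ^ k / N ^ k + 1) (real n / (real n - real k)) *
               rpow (16 * real k / real n) (real k / (real n - real k)))"
  shows "norm (\<xi> * complex_of_real N * I' / F a - II)
           \<le> C * (1 / N + exp (- (\<epsilon> ^ n * N ^ n / 4)))"
proof -
  define B where "B = (SUP z\<in>cball a (r / 2). norm (f z) + r * norm (deriv f z))"
  define Bt where "Bt = (SUP z\<in>cball a (r / 2). norm (ft z))"
  have half: "cball a (r / 2) \<subseteq> ball a r" using disk(1) by auto
  have B_sum: "norm (f z) + r * norm (deriv f z) \<le> B" if "z \<in> cball a (r / 2)" for z
    unfolding B_def using that half
    by (intro le_SUP_compact[where h = "\<lambda>z. norm (f z) + r * norm (deriv f z)"] continuous_intros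
          holomorphic_on_imp_continuous_on holomorphic_on_subset[OF holomorphic(1)]
          holomorphic_on_subset[OF holomorphic_deriv[OF holomorphic(1) open_ball]]) auto
  have B: "norm (f z) \<le> B" "r * norm (deriv f z) \<le> B" if "z \<in> cball a (r / 2)" for z
    using B_sum[OF that] norm_ge_zero[of "f z"]
      mult_nonneg_nonneg[OF less_imp_le[OF disk(1)] norm_ge_zero[of "deriv f z"]]
    by linarith+
  have Bt: "norm (ft z) \<le> Bt" if "z \<in> cball a (r / 2)" for z
    unfolding Bt_def using that half
    by (intro le_SUP_compact[where h = "\<lambda>z. norm (ft z)"] continuous_on_norm
          holomorphic_on_imp_continuous_on holomorphic_on_subset[OF holomorphic(2)]) auto
  have c0: "c \<noteq> 0" using n(2) by (simp add: c)
  have \<rho>0: "\<rho> \<noteq> 0" using c0 n(1) root(1) by (auto simp: power_0_left)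
  have N: "N > 0" using \<rho>0 by (simp add: root(3))
  have \<xi>1: "norm \<xi> = 1" using \<rho>0 by (simp add: root(2) norm_sgn)
  have \<rho>: "\<rho> = of_real N * \<xi>" using \<rho>0 by (simp add: root(2,3) sgn_eq)
  have c_eq: "c = of_real (N ^ n) * \<xi> ^ n"
    using root(1) by (simp add: \<rho> power_mult_distrib)
  have norm_c: "norm c = N ^ n"
    using N \<xi>1 by (simp add: c_eq norm_mult norm_power)
  have "fact n / norm ((deriv ^^ n) f a) = 1 / N ^ n"
    using norm_c[symmetric] by (simp add: c norm_divide)
  then have K0_B: "2 ^ (n + 1) / r ^ (n + 1) * B = K0 * N ^ n"
    using N by (simp add: K0 B_def)
  have \<epsilon>_le: "ereal \<epsilon> \<le> ereal (\<epsilon>0 / 128)" "ereal \<epsilon> \<le> \<epsilon>t0 / 4"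
    using \<epsilon>(2) by auto
  have \<epsilon>_r: "2048 * \<epsilon> \<le> r" and \<epsilon>_K0: "2048 * \<epsilon> \<le> 1 / K0"
    using \<epsilon>_le(1) by (auto simp: \<epsilon>0 min_def split: if_splits)
  have K0_pos: "K0 > 0"
  proof -
    have "0 < 1 / K0" using \<epsilon>(1) \<epsilon>_K0 by linarith
    then show ?thesis by simp
  qed
  have K0_\<epsilon>: "K0 * \<epsilon> \<le> 1 / 2048"
    using \<epsilon>_K0 K0_pos by (simp add: field_simps)

  \<comment> \<open>\<open>K0\<close> is designed so that the Taylor remainder of \<open>f\<close> is relative to the leading term\<close>
  have taylor_f: "norm (f z - f a - c * (z - a) ^ n) \<le> 2 * K0 * N ^ n * norm (z - a) ^ (n + 1)"
    if z: "norm (z - a) \<le> \<epsilon>" for z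
  proof -
    have "norm (f z - f a - c * (z - a) ^ n) \<le> 2 * B * (2 * norm (z - a) / r) ^ (n + 1)"
      unfolding c using z \<epsilon>_r disk(1)
      by (intro taylor_first_nonzero_bound[OF holomorphic(1) disk(1) B(1) n(1,3)]) auto
    also have "\<dots> = 2 * (2 ^ (n + 1) / r ^ (n + 1) * B) * norm (z - a) ^ (n + 1)"
      by (simp add: power_mult_distrib power_divide)
    finally show ?thesis unfolding K0_B by (simp only: mult.assoc)
  qed
  have crit: "deriv f z \<noteq> 0" if z: "z \<noteq> a" "norm (z - a) \<le> \<epsilon>" for z
  proof (rule deriv_nonzero_near_critical_point[OF holomorphic(1) disk(1) B(2) n(1,3) z(1)])
    show "norm (z - a) \<le> r / 4" using z \<epsilon>_r \<epsilon>(1) by simp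
    have "K0 * norm (z - a) \<le> K0 * \<epsilon>"
      using z(2) K0_pos by (intro mult_left_mono) auto
    then have "K0 * norm (z - a) < 1" using K0_\<epsilon> by simp
    then have "(K0 * norm (z - a)) * N ^ n < 1 * N ^ n"
      using N by (intro mult_strict_right_mono) auto
    then show "2 ^ (n + 1) / r ^ (n + 1) * B * norm (z - a) < norm ((deriv ^^ n) f a / fact n)"
      unfolding K0_B using norm_c by (simp add: c mult_ac)
  qed

  define E where "E = rpow (2 * M ^ k / N ^ k + 1) (real n / (real n - real k)) *
               rpow (16 * real k / real n) (real k / (real n - real k))"
  define K2 where "K2 = Kt0 * M ^ k / N ^ k"
  \<comment> \<open>a common form of the two cases: for constant \<open>ut\<close>, where \<open>k = d = Kt0 = 0\<close>, both sides of the Taylor estimate vanish\<close>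
  have tilde: "k \<le> n \<and> 0 \<le> Kt0 \<and> Kt0 * \<epsilon> \<le> 1 / 16 \<and> Kt0 * M ^ k = Kt0 * norm d \<and>
      (\<forall>z. norm (z - a) \<le> \<epsilon> \<longrightarrow>
        norm (ft z - ft a - d * (z - a) ^ k) \<le> 2 * Kt0 * norm d * norm (z - a) ^ (k + 1)) \<and>
      (\<forall>x\<ge>0. 9 / 8 * (norm d / N ^ k) * x ^ k \<le> x ^ n / 16 + E)"
  proof (cases "ut constant_on S")
    case True
    note ut = ut_constant[OF True]
    obtain b where b: "\<And>z. z \<in> S \<Longrightarrow> ut z = b" using True by (auto simp: constant_on_def)
    have "ft z = ft a" if "norm (z - a) \<le> \<epsilon>" for z
    proof (rule holomorphic_constant_if_Re_constant[OF holomorphic(2)])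
      show "Re (ft z) = b" if "z \<in> ball a r" for z
        using that Re_ft b disk(2) by auto
    qed (use that \<epsilon>_r \<epsilon>(1) disk(1) in \<open>auto simp: dist_norm norm_minus_commute\<close>)
    moreover have "0 \<le> E" by (simp add: E_def rpow_def)
    ultimately show ?thesis using ut by auto
  next
    case False
    note ut = ut_nonconstant[OF False]
    then have k: "k \<ge> 1" "k < n" "\<And>m. 1 \<le> m \<Longrightarrow> m < k \<Longrightarrow> (deriv ^^ m) ft a = 0"
      and d: "d = (deriv ^^ k) ft a / fact k" and M: "M = norm d powr (1 / real k)"
      and Kt0: "Kt0 = 2 ^ (k + 1) / r ^ (k + 1) * (Bt / M ^ k)" and \<epsilon>t0: "\<epsilon>t0 = ereal (1 / (4 * Kt0))"
      by (auto simp: Bt_def)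
    have d0: "d \<noteq> 0" using ut by auto
    have M_pos: "M > 0" using d0 by (simp add: M)
    have Mk: "M ^ k = norm d"
      using M_pos k(1) d0 by (simp add: powr_realpow[symmetric]) (simp add: M powr_powr)
    have \<epsilon>Kt: "16 * \<epsilon> \<le> 1 / Kt0"
      using \<epsilon>_le(2) unfolding \<epsilon>t0 by (simp add: field_simps)
    have Kt0_pos: "Kt0 > 0"
    proof -
      have "0 < 1 / Kt0" using \<epsilon>(1) \<epsilon>Kt by linarith
      then show ?thesis by simp
    qed
    have Kt0_\<epsilon>: "Kt0 * \<epsilon> \<le> 1 / 16"
      using \<epsilon>Kt Kt0_pos by (simp add: field_simps)
    have Kt0_Bt: "2 ^ (k + 1) / r ^ (k + 1) * Bt = Kt0 * norm d"
      using M_pos by (simp add: Kt0 Mk[symmetric])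
    have "norm (ft z - ft a - d * (z - a) ^ k) \<le> 2 * Kt0 * norm d * norm (z - a) ^ (k + 1)"
      if z: "norm (z - a) \<le> \<epsilon>" for z
    proof -
      have "norm (ft z - ft a - d * (z - a) ^ k) \<le> 2 * Bt * (2 * norm (z - a) / r) ^ (k + 1)"
        unfolding d using z \<epsilon>_r disk(1)
        by (intro taylor_first_nonzero_bound[OF holomorphic(2) disk(1) Bt k(1,3)]) auto
      also have "\<dots> = 2 * (2 ^ (k + 1) / r ^ (k + 1) * Bt) * norm (z - a) ^ (k + 1)"
        by (simp add: power_mult_distrib power_divide)
      finally show ?thesis unfolding Kt0_Bt by (simp only: mult.assoc)
    qed
    moreover have "9 / 8 * (norm d / N ^ k) * x ^ k \<le> x ^ n / 16 + E" if x: "x \<ge> 0" for x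
    proof -
      define b where "b = 2 * M ^ k / N ^ k + 1"
      \<comment> \<open>the factor \<open>9 / 8\<close> leaves room for the Taylor remainder of \<open>ft\<close>; it is covered by the \<open>2\<close> in \<open>b\<close>\<close>
      have y: "0 \<le> norm d / N ^ k" using N by simp
      have b: "b > 0" "9 / 8 * (norm d / N ^ k) \<le> b"
        using y by (auto simp: b_def Mk)
      have "9 / 8 * (norm d / N ^ k) * x ^ k \<le> b * x ^ k"
        using b x by (intro mult_right_mono) auto
      also have "\<dots> \<le> x ^ n / 16 + b powr (n / (real n - real k)) * (16 * real k / real n) powr (k / (real n - real k))"
        by (rule Young_power) (use k b x in auto)
      also have "\<dots> = x ^ n / 16 + E"
        using b(1) k by (simp add: E_def rpow_def b_def[symmetric])
      finally show ?thesis .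
    qed
    ultimately show ?thesis
      using k Kt0_pos Kt0_\<epsilon> Mk by auto
  qed
  then have k: "k \<le> n" and Kt0_pos: "0 \<le> Kt0" and Kt0_\<epsilon>: "Kt0 * \<epsilon> \<le> 1 / 16"
    and Kt0_d: "Kt0 * M ^ k = Kt0 * norm d"
    and taylor_ft: "\<And>z. norm (z - a) \<le> \<epsilon> \<Longrightarrow>
        norm (ft z - ft a - d * (z - a) ^ k) \<le> 2 * Kt0 * norm d * norm (z - a) ^ (k + 1)"
    and Young: "\<And>x. x \<ge> 0 \<Longrightarrow> 9 / 8 * (norm d / N ^ k) * x ^ k \<le> x ^ n / 16 + E"
    by blast+

  have \<epsilon>r: "\<epsilon> < r" using \<epsilon>_r \<epsilon>(1) by simp
  note exit = steepest_descent_first_exit[OF holomorphic(1) disk(2) Re_f[symmetric] \<Phi> \<epsilon>(1) \<epsilon>r crit \<tau>]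
  define p where "p = \<Phi> \<tau>"
  have p: "norm (p - a) = \<epsilon>" using exit(1) by (simp add: p_def)
  have "p \<noteq> a" using p \<epsilon>(1) by auto
  then have \<eta>1: "norm \<eta> = 1" by (simp add: \<eta> p_def norm_sgn)
  have p_eq: "p = a + of_real \<epsilon> * \<eta>"
    using p \<epsilon>(1) by (simp add: \<eta> p_def[symmetric] sgn_eq)
  define \<omega> where "\<omega> = (\<xi> * \<eta>) ^ n"
  have \<omega>: "Re \<omega> \<le> - (511 / 512)"
  proof (rule descent_direction_estimate)
    show "Im (f p - f a) = 0" "Re (f p - f a) \<le> 0" using exit(2,3) by (auto simp: p_def)
    show "N ^ n * \<epsilon> ^ n > 0" using N \<epsilon>(1) by simp
    show "norm \<omega> = 1" by (simp add: \<omega>_def norm_power norm_mult \<xi>1 \<eta>1)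
    have "c * (p - a) ^ n = of_real (N ^ n * \<epsilon> ^ n) * \<omega>"
      by (simp add: p_eq c_eq \<omega>_def power_mult_distrib mult_ac)
    then have "norm (f p - f a - of_real (N ^ n * \<epsilon> ^ n) * \<omega>) \<le> 2 * (K0 * \<epsilon>) * (N ^ n * \<epsilon> ^ n)"
      using taylor_f[of p] p by (simp add: mult_ac)
    also have "\<dots> \<le> 2 * (1 / 2048) * (N ^ n * \<epsilon> ^ n)"
      using K0_\<epsilon> N \<epsilon>(1) by (intro mult_right_mono) auto
    finally show "norm (f p - f a - of_real (N ^ n * \<epsilon> ^ n) * \<omega>) \<le> N ^ n * \<epsilon> ^ n / 1024" by simp
  qed

  have "(\<lambda>z. exp (f z + ft z)) holomorphic_on ball a r"
    by (intro holomorphic_intros holomorphic)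
  then have F_hol: "F holomorphic_on ball a r"
    by (rule holomorphic_transform) (use F_exp in auto)
  then obtain H where H: "\<And>z. z \<in> ball a r \<Longrightarrow> (H has_field_derivative F z) (at z)"
    using holomorphic_convex_primitive'[OF convex_ball open_ball] by (metis at_within_open open_ball)
  \<comment> \<open>from here on the curve enters only through its endpoint \<open>p\<close>\<close>
  have I'_H: "I' = H p - H a"
    unfolding I' p_def by (rule exit(4)) (use H in auto)

  \<comment> \<open>\<open>z\<close> runs along the segment from \<open>a\<close> to \<open>p\<close>, parametrised by \<open>x = N |z - a|\<close>\<close>
  define L where "L = \<epsilon> * N"
  define \<theta> where "\<theta> = \<eta> * \<xi>"
  define \<delta> where "\<delta> = d / of_real N ^ k * \<eta> ^ k"
  define z where "z = (\<lambda>x::real. a + of_real (x / N) * \<eta>)"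
  define g where "g = (\<lambda>x. (f (z x) - f a - c * (z x - a) ^ n) + (ft (z x) - ft a - d * (z x - a) ^ k))"
  have L: "L \<ge> 0" using \<epsilon>(1) N by (simp add: L_def)
  have norm_\<delta>: "norm \<delta> = norm d / N ^ k"
    using N by (simp add: \<delta>_def norm_mult norm_divide norm_power \<eta>1)
  have norm_z: "norm (z x - a) = x / N" if "0 \<le> x" for x
    using that N by (simp add: z_def norm_mult norm_divide \<eta>1)
  have z_le: "norm (z x - a) \<le> \<epsilon>" if "0 \<le> x" "x \<le> L" for x
    using that N by (simp add: norm_z L_def field_simps)
  have z_in: "z x \<in> ball a r" if "0 \<le> x" "x \<le> L" for x
    using z_le[OF that] \<epsilon>r by (auto simp: dist_norm norm_minus_commute)
  have z_cont: "continuous_on {0..L} z"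
    unfolding z_def using N by (intro continuous_intros) auto
  have F_z: "\<xi> * of_real N / F a * (F (z x) * (\<eta> / of_real N))
      = \<theta> * exp (\<omega> * of_real x ^ n + \<delta> * of_real x ^ k + g x)" if x: "0 \<le> x" "x \<le> L" for x
  proof -
    have "c * (z x - a) ^ n = \<omega> * of_real x ^ n"
      using N by (simp add: z_def c_eq \<omega>_def power_mult_distrib power_divide)
    moreover have "d * (z x - a) ^ k = \<delta> * of_real x ^ k"
      using N by (simp add: z_def \<delta>_def power_mult_distrib power_divide)
    ultimately have "\<omega> * of_real x ^ n + \<delta> * of_real x ^ k + g x = (f (z x) + ft (z x)) - (f a + ft a)"
      by (simp add: g_def)
    moreover have "exp ((f (z x) + ft (z x)) - (f a + ft a)) = F (z x) / F a"
      using F_exp[OF z_in[OF x]] F_exp[of a] disk(1) by (simp add: exp_diff)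
    ultimately show ?thesis using N by (simp add: \<theta>_def)
  qed
  have F_z_cont: "continuous_on {0..L} (\<lambda>x. F (z x))"
    by (rule continuous_on_compose2[OF holomorphic_on_imp_continuous_on[OF F_hol] z_cont]) (use z_in in auto)
  have "(LINT x:{0..L}|lborel. F (z x) * (\<eta> / of_real N)) = H (z L) - H (z 0)"
    unfolding set_lebesgue_integral_def
  proof (rule integral_FTC_Icc[OF L])
    fix x assume x: "0 \<le> x" "x \<le> L"
    have "(z has_vector_derivative \<eta> / of_real N) (at x)"
      unfolding z_def using N by (auto intro!: derivative_eq_intros simp: has_vector_derivative_def scaleR_conv_of_real)
    from field_vector_diff_chain_at[OF this H[OF z_in[OF x]]]
    have "((\<lambda>x. H (z x)) has_vector_derivative F (z x) * (\<eta> / of_real N)) (at x)"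
      by (simp add: o_def mult.commute)
    then show "((\<lambda>x. H (z x)) has_vector_derivative F (z x) * (\<eta> / of_real N)) (at x within {0..L})"
      by (rule has_vector_derivative_at_within)
  qed (intro continuous_intros F_z_cont)
  also have "\<dots> = I'"
    using N by (simp add: I'_H p_eq z_def L_def)
  finally have "\<xi> * of_real N * I' / F a
      = \<xi> * of_real N / F a * (LINT x:{0..L}|lborel. F (z x) * (\<eta> / of_real N))"
    by simp
  also have "\<dots> = (LINT x:{0..L}|lborel. \<xi> * of_real N / F a * (F (z x) * (\<eta> / of_real N)))"
    by (rule set_integral_mult_right[symmetric])
  also have "\<dots> = (LINT x:{0..L}|lborel. \<theta> * exp (\<omega> * of_real x ^ n + \<delta> * of_real x ^ k + g x))"
    by (rule set_lebesgue_integral_cong) (use F_z in auto)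
  finally have I'_eq: "\<xi> * of_real N * I' / F a
      = (LINT x:{0..L}|lborel. \<theta> * exp (\<omega> * of_real x ^ n + \<delta> * of_real x ^ k + g x))" .
  have \<xi>k: "cnj \<xi> ^ k * \<xi> ^ k = 1"
    using \<xi>1 complex_norm_square[of \<xi>] by (simp flip: power_mult_distrib add: mult.commute)
  have ray: "exp ((of_real x * (\<eta> * \<xi>)) ^ n + d / of_real N ^ k * cnj \<xi> ^ k * (of_real x * (\<eta> * \<xi>)) ^ k) * (\<eta> * \<xi>)
      = \<theta> * exp (\<omega> * of_real x ^ n + \<delta> * of_real x ^ k)" for x :: real
  proof -
    have "(of_real x * (\<eta> * \<xi>)) ^ n = \<omega> * of_real x ^ n"
      by (simp add: \<omega>_def power_mult_distrib mult_ac)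
    moreover have "d / of_real N ^ k * cnj \<xi> ^ k * (of_real x * (\<eta> * \<xi>)) ^ k
        = \<delta> * of_real x ^ k * (cnj \<xi> ^ k * \<xi> ^ k)"
      by (simp add: \<delta>_def power_mult_distrib mult_ac)
    ultimately show ?thesis by (simp add: \<xi>k \<theta>_def)
  qed
  have II_eq: "II = (LINT x:{0..}|lborel. \<theta> * exp (\<omega> * of_real x ^ n + \<delta> * of_real x ^ k))"
    unfolding II ray_integral_def ray ..

  have remainder: "norm (g x) \<le> (2 * K0 * N ^ n * (x / N) ^ (n + 1)) + 2 * Kt0 * norm d * (x / N) ^ (k + 1)"
    if "0 \<le> x" "x \<le> L" for x
    unfolding g_def using taylor_f[OF z_le[OF that]] taylor_ft[OF z_le[OF that]] norm_z[OF that(1)]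
    by (intro norm_triangle_le add_mono) auto
  have "norm (\<xi> * of_real N * I' / F a - II) \<le> 256 * (K0 + K2 + 1) * exp E * (1 / N + exp (- (L ^ n / 4)))"
    unfolding I'_eq II_eq
  proof (rule Laplace_comparison[OF n(1) k N L _ _ _ \<omega>])
    show "0 \<le> K0" "norm \<theta> = 1" using K0_pos by (auto simp: \<theta>_def norm_mult \<eta>1 \<xi>1)
    show "0 \<le> K2" using Kt0_pos N by (simp add: K2_def Kt0_d)
    show "continuous_on {0..L} g"
      unfolding g_def
      by (intro continuous_intros z_cont continuous_on_compose2[OF holomorphic_on_imp_continuous_on[OF holomorphic(1)] z_cont]
            continuous_on_compose2[OF holomorphic_on_imp_continuous_on[OF holomorphic(2)] z_cont]) (use z_in in auto)
    show "9 / 8 * norm \<delta> * x ^ k \<le> x ^ n / 16 + E" if "0 \<le> x" for x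
      using Young[OF that] by (simp add: norm_\<delta>)
    fix x assume x: "0 \<le> x" "x \<le> L"
    have "2 * K0 * N ^ n * (x / N) ^ (n + 1) + 2 * Kt0 * norm d * (x / N) ^ (k + 1)
        = 2 / N * (K0 * x ^ (n + 1) + K2 * x ^ (k + 1))"
      using N by (simp add: K2_def Kt0_d power_divide field_simps)
    then show "norm (g x) \<le> 2 / N * (K0 * x ^ (n + 1) + K2 * x ^ (k + 1))"
      using remainder[OF x] by simp
    have x\<epsilon>: "x / N \<le> \<epsilon>" using x N by (simp add: L_def field_simps)
    have K0x: "K0 * (x / N) \<le> 1 / 2048"
      using mult_left_mono[OF x\<epsilon>, of K0] K0_\<epsilon> K0_pos by linarith
    have Kt0x: "Kt0 * (x / N) \<le> 1 / 16"
      using mult_left_mono[OF x\<epsilon>, of Kt0] Kt0_\<epsilon> Kt0_pos by linarith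
    have "2 * K0 * N ^ n * (x / N) ^ (n + 1) = 2 * (K0 * (x / N)) * x ^ n"
      using N by (simp add: power_divide)
    also have "\<dots> \<le> 2 * (1 / 2048) * x ^ n"
      by (rule mult_right_mono[OF mult_left_mono[OF K0x]]) (use x in auto)
    finally have small_f: "2 * K0 * N ^ n * (x / N) ^ (n + 1) \<le> x ^ n / 1024" by simp
    have "2 * Kt0 * norm d * (x / N) ^ (k + 1) = 2 * (Kt0 * (x / N)) * (norm \<delta> * x ^ k)"
      using N by (simp add: power_divide norm_\<delta>)
    also have "\<dots> \<le> 2 * (1 / 16) * (norm \<delta> * x ^ k)"
      by (rule mult_right_mono[OF mult_left_mono[OF Kt0x]]) (use x in auto)
    finally have small_ft: "2 * Kt0 * norm d * (x / N) ^ (k + 1) \<le> norm \<delta> * x ^ k / 8" by simp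
    show "norm (g x) \<le> x ^ n / 1024 + norm \<delta> * x ^ k / 8"
      using remainder[OF x] small_f small_ft by linarith
  qed
  also have "\<dots> \<le> 128 * fact (n + 1) * (K0 + K2 + 1) * exp E * (1 / N + exp (- (L ^ n / 4)))"
  proof -
    have "(2::real) \<le> fact (n + 1)"
      using fact_mono[of 2 "n + 1", where 'a = real] n(1) by (simp add: fact_2)
    then have "(256::real) \<le> 128 * fact (n + 1)" by linarith
    moreover have "0 \<le> K2" using Kt0_pos N by (simp add: K2_def Kt0_d)
    ultimately show ?thesis
      using K0_pos N by (intro mult_right_mono) auto
  qed
  also have "\<dots> = C * (1 / N + exp (- (\<epsilon> ^ n * N ^ n / 4)))"
    by (simp only: C K2_def E_def L_def power_mult_distrib)
  finally show ?thesis .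
qed

end
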